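(* Let $\mathbb{F}$ be a field of characteristic zero and let $\mathcal{R}$ be an associative PI-algebra over $\mathbb{F}$ with $\mathrm{exp}(\mathcal{R})\ge 1$ (for instance, $\mathcal{R}$ unital). Then, for positive integers $r,s$, $\mathrm{Id}(M_r(\mathcal{R}))\subseteq\mathrm{Id}(M_s(\mathcal{R}))$ if and only if $r\ge s$. In particular, $\mathrm{Id}(M_r(\mathcal{R}))=\mathrm{Id}(M_s(\mathcal{R}))$ if and only if $r=s$.
   Context: Algebras are associative, not necessarily unital. $\mathrm{Id}(\mathcal{A})$ denotes the set of all polynomial identities of $\mathcal{A}$ in the free associative algebra $\mathbb{F}\langle X\rangle$ on $X=\{x_1,x_2,\ldots\}$; $\mathcal{A}$ is a PI-algebra if $\mathrm{Id}(\mathcal{A})\ne 0$. Let $P_m=\mathrm{Span}\{x_{\sigma(1)}\cdots x_{\sigma(m)}\mid\sigma\in S_m\}$ and $c_m(\mathcal{A})=\dim\left(P_m/(P_m\cap\mathrm{Id}(\mathcal{A}))\right)$. The PI-exponent of a PI-algebra is $\mathrm{exp}(\mathcal{A})=\lim_{m\to\infty}\sqrt[m]{c_m(\mathcal{A})}$; in characteristic zero this limit is known to exist and to be a non-negative integer (Giambruno–Zaicev). $M_n(\mathcal{R})$ is the algebra of $n\times n$ matrices over $\mathcal{R}$. *)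

theory Defs
  imports
    Complex_Main
    "HOL-Library.Poly_Mapping"
    "HOL-Library.Function_Algebras"
    "HOL-Combinatorics.Permutations"
begin

text \<open>
  The addition of an algebra is that of the ambient type; the carrier is a subset of this type,
  so that the algebras \<open>M\<^sub>n(R)\<close> for all \<open>n\<close> live in one type.
\<close>

record ('k, 'a) alg =
  alg_carrier :: "'a set"
  alg_scale :: "'k \<Rightarrow> 'a \<Rightarrow> 'a"
  alg_mult :: "'a \<Rightarrow> 'a \<Rightarrow> 'a"

locale assoc_algebra =
  fixes A :: "('k::field, 'a::ab_group_add) alg"
  assumes zero_closed: "0 \<in> alg_carrier A"
    and add_closed: "\<lbrakk>x \<in> alg_carrier A; y \<in> alg_carrier A\<rbrakk> \<Longrightarrow> x + y \<in> alg_carrier A"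
    and scale_closed: "x \<in> alg_carrier A \<Longrightarrow> alg_scale A c x \<in> alg_carrier A"
    and mult_closed:
      "\<lbrakk>x \<in> alg_carrier A; y \<in> alg_carrier A\<rbrakk> \<Longrightarrow> alg_mult A x y \<in> alg_carrier A"
    and scale_right_distrib: "\<lbrakk>x \<in> alg_carrier A; y \<in> alg_carrier A\<rbrakk> \<Longrightarrow>
      alg_scale A c (x + y) = alg_scale A c x + alg_scale A c y"
    and scale_left_distrib: "x \<in> alg_carrier A \<Longrightarrow>
      alg_scale A (c + d) x = alg_scale A c x + alg_scale A d x"
    and scale_scale: "x \<in> alg_carrier A \<Longrightarrow>
      alg_scale A c (alg_scale A d x) = alg_scale A (c * d) x"
    and scale_one: "x \<in> alg_carrier A \<Longrightarrow> alg_scale A 1 x = x"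
    and mult_assoc: "\<lbrakk>x \<in> alg_carrier A; y \<in> alg_carrier A; z \<in> alg_carrier A\<rbrakk> \<Longrightarrow>
      alg_mult A (alg_mult A x y) z = alg_mult A x (alg_mult A y z)"
    and distrib_left: "\<lbrakk>x \<in> alg_carrier A; y \<in> alg_carrier A; z \<in> alg_carrier A\<rbrakk> \<Longrightarrow>
      alg_mult A x (y + z) = alg_mult A x y + alg_mult A x z"
    and distrib_right: "\<lbrakk>x \<in> alg_carrier A; y \<in> alg_carrier A; z \<in> alg_carrier A\<rbrakk> \<Longrightarrow>
      alg_mult A (x + y) z = alg_mult A x z + alg_mult A y z"
    and mult_scale_left: "\<lbrakk>x \<in> alg_carrier A; y \<in> alg_carrier A\<rbrakk> \<Longrightarrow>
      alg_mult A (alg_scale A c x) y = alg_scale A c (alg_mult A x y)"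
    and mult_scale_right: "\<lbrakk>x \<in> alg_carrier A; y \<in> alg_carrier A\<rbrakk> \<Longrightarrow>
      alg_mult A x (alg_scale A c y) = alg_scale A c (alg_mult A x y)"
begin

lemma scale_zero_right: "alg_scale A c 0 = 0"
  using scale_right_distrib[OF zero_closed zero_closed, of c] by simp

lemma mult_zero_left: "y \<in> alg_carrier A \<Longrightarrow> alg_mult A 0 y = 0"
  using distrib_right[OF zero_closed zero_closed, of y] by simp

lemma mult_zero_right: "x \<in> alg_carrier A \<Longrightarrow> alg_mult A x 0 = 0"
  using distrib_left[OF _ zero_closed zero_closed, of x] by simp

lemma sum_closed: "(\<And>i. i \<in> I \<Longrightarrow> f i \<in> alg_carrier A) \<Longrightarrow> sum f I \<in> alg_carrier A"
  by (induction I rule: infinite_finite_induct) (auto intro: zero_closed add_closed)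

lemma scale_sum: "(\<And>i. i \<in> I \<Longrightarrow> f i \<in> alg_carrier A) \<Longrightarrow>
    alg_scale A c (sum f I) = (\<Sum>i\<in>I. alg_scale A c (f i))"
  by (induction I rule: infinite_finite_induct)
    (auto simp: scale_zero_right scale_right_distrib sum_closed)

lemma mult_sum_left: "(\<And>i. i \<in> I \<Longrightarrow> f i \<in> alg_carrier A) \<Longrightarrow> y \<in> alg_carrier A \<Longrightarrow>
    alg_mult A (sum f I) y = (\<Sum>i\<in>I. alg_mult A (f i) y)"
  by (induction I rule: infinite_finite_induct)
    (auto simp: mult_zero_left distrib_right sum_closed)

lemma mult_sum_right: "(\<And>i. i \<in> I \<Longrightarrow> f i \<in> alg_carrier A) \<Longrightarrow> x \<in> alg_carrier A \<Longrightarrow>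
    alg_mult A x (sum f I) = (\<Sum>i\<in>I. alg_mult A x (f i))"
  by (induction I rule: infinite_finite_induct)
    (auto simp: mult_zero_right distrib_left sum_closed)

end

text \<open>
  An \<open>n \<times> n\<close> matrix is a function on pairs of indices that vanishes
  unless both indices are below \<open>n\<close>.
\<close>

definition mat_alg :: "nat \<Rightarrow> ('k, 'a::ab_group_add) alg \<Rightarrow> ('k, nat \<Rightarrow> nat \<Rightarrow> 'a) alg" where
  "mat_alg n R = \<lparr>
     alg_carrier = {M. (\<forall>i<n. \<forall>j<n. M i j \<in> alg_carrier R) \<and>
                       (\<forall>i j. \<not> (i < n \<and> j < n) \<longrightarrow> M i j = 0)},
     alg_scale = (\<lambda>c M i j. alg_scale R c (M i j)),
     alg_mult = (\<lambda>M N i j. \<Sum>k<n. alg_mult R (M i k) (N k j))\<rparr>"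

lemma (in assoc_algebra) mat_alg_entry:
  "M \<in> alg_carrier (mat_alg n A) \<Longrightarrow> M i j \<in> alg_carrier A"
  by (cases "i < n \<and> j < n") (auto simp: mat_alg_def zero_closed)

lemma (in assoc_algebra) assoc_algebra_mat_alg: "assoc_algebra (mat_alg n A)"
proof (unfold_locales, goal_cases)
  case (9 x y z)
  note e = mat_alg_entry[OF 9(1)] mat_alg_entry[OF 9(2)] mat_alg_entry[OF 9(3)]
  show ?case
  proof (intro ext)
    fix i j
    have "alg_mult (mat_alg n A) (alg_mult (mat_alg n A) x y) z i j =
        (\<Sum>l<n. \<Sum>k<n. alg_mult A (alg_mult A (x i k) (y k l)) (z l j))"
      unfolding mat_alg_def alg.simps
      by (intro sum.cong refl mult_sum_left mult_closed e)
    also have "\<dots> = (\<Sum>k<n. \<Sum>l<n. alg_mult A (x i k) (alg_mult A (y k l) (z l j)))"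
      by (subst sum.swap) (intro sum.cong refl mult_assoc e)
    also have "\<dots> = alg_mult (mat_alg n A) x (alg_mult (mat_alg n A) y z) i j"
      unfolding mat_alg_def alg.simps
      by (intro sum.cong refl mult_sum_right[symmetric] mult_closed e)
    finally show "alg_mult (mat_alg n A) (alg_mult (mat_alg n A) x y) z i j =
        alg_mult (mat_alg n A) x (alg_mult (mat_alg n A) y z) i j" .
  qed
next
  case (4 x y)
  note e = mat_alg_entry[OF 4(1)] mat_alg_entry[OF 4(2)]
  have x0: "x i j = 0" and y0: "y i j = 0" if "\<not> (i < n \<and> j < n)" for i j
    using 4 that by (auto simp: mat_alg_def)
  have "(\<Sum>k<n. alg_mult A (x i k) (y k j)) = 0" if "\<not> (i < n \<and> j < n)" for i j
  proof (cases "i < n")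
    case True
    then show ?thesis using that y0 by (simp add: mult_zero_right e)
  next
    case False
    then show ?thesis using that x0 by (simp add: mult_zero_left e)
  qed
  moreover have "(\<Sum>k<n. alg_mult A (x i k) (y k j)) \<in> alg_carrier A" for i j
    by (intro sum_closed mult_closed e)
  ultimately show ?case unfolding mat_alg_def by simp
next
  case (10 x y z)
  note e = mat_alg_entry[OF 10(1)] mat_alg_entry[OF 10(2)] mat_alg_entry[OF 10(3)]
  show ?case by (simp add: mat_alg_def fun_eq_iff distrib_left e sum.distrib)
next
  case (11 x y z)
  note e = mat_alg_entry[OF 11(1)] mat_alg_entry[OF 11(2)] mat_alg_entry[OF 11(3)]
  show ?case by (simp add: mat_alg_def fun_eq_iff distrib_right e sum.distrib)
next
  case (12 x y c)
  note e = mat_alg_entry[OF 12(1)] mat_alg_entry[OF 12(2)]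
  show ?case by (simp add: mat_alg_def fun_eq_iff mult_scale_left scale_sum mult_closed e)
next
  case (13 x y c)
  note e = mat_alg_entry[OF 13(1)] mat_alg_entry[OF 13(2)]
  show ?case by (simp add: mat_alg_def fun_eq_iff mult_scale_right scale_sum mult_closed e)
next
  case (5 x y c)
  note e = mat_alg_entry[OF 5(1)] mat_alg_entry[OF 5(2)]
  show ?case by (simp add: mat_alg_def fun_eq_iff scale_right_distrib e)
next
  case (6 x c d)
  note e = mat_alg_entry[OF 6(1)]
  show ?case by (simp add: mat_alg_def fun_eq_iff scale_left_distrib e)
next
  case (7 x c d)
  note e = mat_alg_entry[OF 7(1)]
  show ?case by (simp add: mat_alg_def fun_eq_iff scale_scale e)
next
  case (8 x)
  note e = mat_alg_entry[OF 8(1)]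
  show ?case by (simp add: mat_alg_def fun_eq_iff scale_one e)
qed (auto simp: mat_alg_def zero_closed add_closed scale_closed scale_zero_right)

text \<open>
  A word is the list of the indices of its letters (the variables are indexed from \<open>0\<close>).
  As algebras have no unit, the free algebra is spanned by the nonempty words.
  Only its vector space structure and the evaluation of its elements are needed here.
\<close>

type_synonym 'k ncpoly = "nat list \<Rightarrow>\<^sub>0 'k"

definition free_alg :: "'k::field ncpoly set" where
  "free_alg = {f. Poly_Mapping.lookup f [] = 0}"

definition ncpoly_scale :: "'k::field \<Rightarrow> 'k ncpoly \<Rightarrow> 'k ncpoly" where
  "ncpoly_scale c f = Poly_Mapping.map (\<lambda>x. c * x) f"

lemma lookup_ncpoly_scale [simp]: "Poly_Mapping.lookup (ncpoly_scale c f) w = c * Poly_Mapping.lookup f w"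
  unfolding ncpoly_scale_def by transfer (simp add: when_def)

global_interpretation ncpoly: vector_space "ncpoly_scale :: 'k::field \<Rightarrow> _"
  by unfold_locales (auto intro!: poly_mapping_eqI simp: lookup_add algebra_simps)

text \<open>The value on the empty word is irrelevant, since it has coefficient \<open>0\<close> in \<^term>\<open>free_alg\<close>.\<close>

fun eval_word :: "('k, 'a::zero) alg \<Rightarrow> (nat \<Rightarrow> 'a) \<Rightarrow> nat list \<Rightarrow> 'a" where
  "eval_word A v [] = 0"
| "eval_word A v [i] = v i"
| "eval_word A v (i # j # w) = alg_mult A (v i) (eval_word A v (j # w))"

definition eval_poly :: "('k::field, 'a::ab_group_add) alg \<Rightarrow> (nat \<Rightarrow> 'a) \<Rightarrow> 'k ncpoly \<Rightarrow> 'a" where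
  "eval_poly A v f = (\<Sum>w\<in>Poly_Mapping.keys f. alg_scale A (Poly_Mapping.lookup f w) (eval_word A v w))"

definition identities :: "('k::field, 'a::ab_group_add) alg \<Rightarrow> 'k ncpoly set" where
  "identities A = {f \<in> free_alg. \<forall>v. (\<forall>i. v i \<in> alg_carrier A) \<longrightarrow> eval_poly A v f = 0}"

definition PI_algebra :: "('k::field, 'a::ab_group_add) alg \<Rightarrow> bool" where
  "PI_algebra A \<longleftrightarrow> assoc_algebra A \<and> identities A \<noteq> {0}"

text \<open>For \<open>m = 0\<close> this is not contained in \<^term>\<open>free_alg\<close>; only large \<open>m\<close> matter below.\<close>

definition multilinear :: "nat \<Rightarrow> 'k::field ncpoly set" where
  "multilinear m = ncpoly.span {Poly_Mapping.single (map \<sigma> [0..<m]) 1 | \<sigma>. \<sigma> permutes {..<m}}"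

text \<open>
  \<open>B\<close> is a set of representatives of a basis of the quotient space \<open>V / W\<close>: their cosets are
  linearly independent (in particular distinct) and span \<open>V / W\<close>.
\<close>

definition quotient_basis :: "'k::field ncpoly set \<Rightarrow> 'k ncpoly set \<Rightarrow> 'k ncpoly set \<Rightarrow> bool" where
  "quotient_basis V W B \<longleftrightarrow> B \<subseteq> V \<and>
     (\<forall>S c. finite S \<and> S \<subseteq> B \<and> (\<Sum>b\<in>S. ncpoly_scale (c b) b) \<in> W \<longrightarrow> (\<forall>b\<in>S. c b = 0)) \<and>
     (\<forall>f\<in>V. \<exists>g\<in>ncpoly.span B. f - g \<in> W)"

definition quotient_dim :: "'k::field ncpoly set \<Rightarrow> 'k ncpoly set \<Rightarrow> nat" where
  "quotient_dim V W = card (SOME B. quotient_basis V W B)"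

text \<open>Hence, for finite-dimensional \<open>V\<close>, the choice of the basis is immaterial.\<close>

lemma quotient_basis_card:
  assumes B: "quotient_basis V W B" and V: "ncpoly.subspace V" and W: "ncpoly.subspace W" "W \<subseteq> V"
    and F: "finite F" "V \<subseteq> ncpoly.span F"
  shows "finite B \<and> card B + ncpoly.dim W = ncpoly.dim V"
proof -
  obtain C where C: "C \<subseteq> W" "ncpoly.independent C" "W \<subseteq> ncpoly.span C" "card C = ncpoly.dim W"
    by (rule ncpoly.basis_exists[of W])
  have BV: "B \<subseteq> V" using B by (simp add: quotient_basis_def)
  have spC: "ncpoly.span C = W" using ncpoly.span_minimal[OF C(1) W(1)] C(3) by blast
  have ind: "\<forall>b\<in>S. c b = 0"
    if "finite S" "S \<subseteq> B" "(\<Sum>b\<in>S. ncpoly_scale (c b) b) \<in> W" for S c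
    using B that unfolding quotient_basis_def by blast
  have disj: "B \<inter> C = {}"
  proof (rule ccontr)
    assume "B \<inter> C \<noteq> {}"
    then obtain b where "b \<in> B" "b \<in> C" by blast
    then have "b \<in> W" using C by blast
    then show False using ind[of "{b}" "\<lambda>_. 1"] \<open>b \<in> B\<close> by simp
  qed
  have indep: "ncpoly.independent (B \<union> C)"
  proof
    assume "ncpoly.dependent (B \<union> C)"
    then obtain S u v where S: "finite S" "S \<subseteq> B \<union> C" "(\<Sum>v\<in>S. ncpoly_scale (u v) v) = 0"
      and v: "v \<in> S" "u v \<noteq> 0"
      unfolding ncpoly.dependent_explicit by blast
    have split: "S = (S \<inter> B) \<union> (S \<inter> C)" using S by blast
    have "0 = (\<Sum>v\<in>(S \<inter> B) \<union> (S \<inter> C). ncpoly_scale (u v) v)" using S(3) split[symmetric] by simp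
    also have "\<dots> = (\<Sum>v\<in>S \<inter> B. ncpoly_scale (u v) v) + (\<Sum>v\<in>S \<inter> C. ncpoly_scale (u v) v)"
      using S disj by (intro sum.union_disjoint) auto
    finally have eq: "(\<Sum>v\<in>S \<inter> B. ncpoly_scale (u v) v) = - (\<Sum>v\<in>S \<inter> C. ncpoly_scale (u v) v)"
      by (simp add: eq_neg_iff_add_eq_0)
    have "(\<Sum>v\<in>S \<inter> C. ncpoly_scale (u v) v) \<in> W"
      using C(1) by (intro ncpoly.subspace_sum[OF W(1)] ncpoly.subspace_scale[OF W(1)]) auto
    then have "(\<Sum>v\<in>S \<inter> B. ncpoly_scale (u v) v) \<in> W"
      using eq ncpoly.subspace_neg[OF W(1)] by simp
    then have B0: "\<forall>b\<in>S \<inter> B. u b = 0" using ind[of "S \<inter> B" u] S by simp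
    then have "(\<Sum>v\<in>S \<inter> C. ncpoly_scale (u v) v) = 0" using eq by simp
    then have "\<forall>b\<in>S \<inter> C. u b = 0"
      using C(2) S(1) unfolding ncpoly.dependent_explicit by blast
    then show False using B0 v split by blast
  qed
  have span: "V \<subseteq> ncpoly.span (B \<union> C)"
  proof
    fix f assume "f \<in> V"
    then obtain g where "g \<in> ncpoly.span B" "f - g \<in> W"
      using B unfolding quotient_basis_def by blast
    then have "g \<in> ncpoly.span (B \<union> C)" "f - g \<in> ncpoly.span (B \<union> C)"
      using spC ncpoly.span_mono[of _ "B \<union> C"] by blast+
    then have "g + (f - g) \<in> ncpoly.span (B \<union> C)" by (rule ncpoly.span_add)
    then show "f \<in> ncpoly.span (B \<union> C)" by simp
  qed
  have sub: "B \<union> C \<subseteq> V" using BV C(1) W(2) by blast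
  have fin: "finite (B \<union> C)"
    using ncpoly.independent_span_bound[OF F(1) indep] sub F(2) by blast
  have "card (B \<union> C) = ncpoly.dim V"
    using ncpoly.dim_unique[OF sub span indep refl] by simp
  then show ?thesis using fin disj C(4) by (simp add: card_Un_disjoint)
qed

lemma quotient_basis_exists:
  assumes V: "ncpoly.subspace V" and W: "ncpoly.subspace W" "W \<subseteq> V"
  shows "\<exists>B. quotient_basis V W B"
proof -
  obtain C where C: "C \<subseteq> W" "ncpoly.independent C" "W \<subseteq> ncpoly.span C"
    by (rule ncpoly.basis_exists[of W])
  have CV: "C \<subseteq> V" using C(1) W(2) by (rule subset_trans)
  obtain D where D: "C \<subseteq> D" "D \<subseteq> V" "ncpoly.independent D" "V \<subseteq> ncpoly.span D"
    by (rule ncpoly.maximal_independent_subset_extend[OF CV C(2)])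
  have spC: "ncpoly.span C = W" using ncpoly.span_minimal[OF C(1) W(1)] C(3) by blast
  have "quotient_basis V W (D - C)"
    unfolding quotient_basis_def
  proof (intro conjI allI impI ballI)
    fix S c b
    assume S: "finite S \<and> S \<subseteq> D - C \<and> (\<Sum>b\<in>S. ncpoly_scale (c b) b) \<in> W" and b: "b \<in> S"
    then have "(\<Sum>b\<in>S. ncpoly_scale (c b) b) \<in> ncpoly.span C" using spC by simp
    then obtain T u where T: "finite T" "T \<subseteq> C"
      "(\<Sum>b\<in>S. ncpoly_scale (c b) b) = (\<Sum>a\<in>T. ncpoly_scale (u a) a)"
      unfolding ncpoly.span_explicit by blast
    let ?w = "\<lambda>x. if x \<in> S then c x else - u x"
    have dis: "S \<inter> T = {}" using S T by blast
    have "(\<Sum>x\<in>S \<union> T. ncpoly_scale (?w x) x) =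
        (\<Sum>x\<in>S. ncpoly_scale (?w x) x) + (\<Sum>x\<in>T. ncpoly_scale (?w x) x)"
      using S T dis by (intro sum.union_disjoint) auto
    also have "(\<Sum>x\<in>T. ncpoly_scale (?w x) x) = - (\<Sum>x\<in>T. ncpoly_scale (u x) x)"
      unfolding sum_negf[symmetric] using dis by (intro sum.cong) auto
    also have "(\<Sum>x\<in>S. ncpoly_scale (?w x) x) = (\<Sum>x\<in>S. ncpoly_scale (c x) x)"
      by (intro sum.cong) auto
    finally have sum0: "(\<Sum>x\<in>S \<union> T. ncpoly_scale (?w x) x) = 0" unfolding T(3) by simp
    have "finite (S \<union> T)" "S \<union> T \<subseteq> D" "b \<in> S \<union> T" using S T D(1) b by auto
    then have "?w b = 0" using ncpoly.independentD[OF D(3) _ _ sum0] by blast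
    then show "c b = 0" using b by simp
  next
    fix f assume "f \<in> V"
    moreover have "(D - C) \<union> C = D" using D(1) by blast
    ultimately have "f \<in> ncpoly.span ((D - C) \<union> C)" using D(4) by auto
    then obtain g h where "g \<in> ncpoly.span (D - C)" "h \<in> ncpoly.span C" "f = g + h"
      unfolding ncpoly.span_Un by blast
    then show "\<exists>g\<in>ncpoly.span (D - C). f - g \<in> W" using spC by auto
  qed (use D in auto)
  then show ?thesis by blast
qed

lemma quotient_dim_eq:
  assumes "ncpoly.subspace V" "ncpoly.subspace W" "W \<subseteq> V" "finite F" "V \<subseteq> ncpoly.span F"
  shows "quotient_dim V W + ncpoly.dim W = ncpoly.dim V"
  unfolding quotient_dim_def
  using quotient_basis_card[OF someI_ex[OF quotient_basis_exists[OF assms(1-3)]] assms] by simp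

definition codim :: "nat \<Rightarrow> ('k::field, 'a::ab_group_add) alg \<Rightarrow> nat" where
  "codim m A = quotient_dim (multilinear m) (multilinear m \<inter> identities A)"

definition PI_exp :: "('k::field, 'a::ab_group_add) alg \<Rightarrow> real" where
  "PI_exp A = lim (\<lambda>m. root m (real (codim m A)))"

end

theory Submission
  imports Defs "HOL-Combinatorics.Multiset_Permutations" "HOL-Library.Sublist"
begin

text \<open>
  Evaluating multilinear polynomials at matrix units shows that \<open>f\<close> is an identity of \<open>M\<^sub>n(R)\<close> iff
  for all maps of the variables to edges of the complete digraph on \<open>n\<close> vertices and all vertices
  \<open>a\<close>, \<open>b\<close>, the part of \<open>f\<close> formed by the words that are walks from \<open>a\<close> to \<open>b\<close> is an identity of \<open>R\<close>.
  As \<open>M\<^sub>a(M\<^sub>b(R)) = M\<^sub>a\<^sub>b(R)\<close>, an inclusion of the identities of \<open>M\<^sub>r(R)\<close> in those of \<open>M\<^sub>s(R)\<close> with \<open>r < s\<close>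
  passes to \<open>n = r\<^sup>k\<close> and \<open>N = s\<^sup>k\<close> for all \<open>k\<close>, which makes \<open>N / n\<close> as large as we like.

  If \<open>R\<close> satisfies an identity of degree \<open>D + 1\<close>, then by Latyshev's lemma the multilinear polynomials
  of degree \<open>m\<close> are spanned modulo \<open>Id(R)\<close> by the permutations that are unions of \<open>D\<close> increasing
  sequences, of which there are at most \<open>D\<^sup>2\<^sup>m\<close>. So the identities of \<open>M\<^sub>n(R)\<close> are cut out by at most
  \<open>n\<^sup>2\<^sup>m\<^sup>+\<^sup>2 D\<^sup>2\<^sup>m\<close> linear equations. On the other hand, if \<open>R\<close> is not nilpotent, no nonzero combination of
  permutations that are unions of \<open>N\<close> increasing sequences is an identity of \<open>M\<^sub>N(R)\<close>: the colouring
  by the sequences yields a walk on \<open>N\<close> vertices that the permutation follows greedily. For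
  \<open>N \<ge> 2 L\<close> and \<open>m = L\<^sup>2\<close> there are at least \<open>(L!)\<^sup>2\<^sup>L\<close> such permutations, which exceeds the number of equations
  once \<open>L > 6 D n\<close>. Finally, a nilpotent \<open>R\<close> has PI-exponent \<open>0\<close>, whatever one knows about the existence
  of the limit in general.
\<close>

section \<open>Linear algebra: more unknowns than equations\<close>

text \<open>Gaussian elimination: an equation that involves \<open>u0\<close> is solved for the
  value at \<open>u0\<close>, and substituting it into the others leaves one equation and one
  unknown less.\<close>

lemma underdetermined_system:
  fixes M :: "'e \<Rightarrow> 'u \<Rightarrow> 'k::field"
  assumes "finite E" "finite U" "card E < card U"
  shows "\<exists>c. (\<exists>u\<in>U. c u \<noteq> 0) \<and> (\<forall>e\<in>E. (\<Sum>u\<in>U. c u * M e u) = 0)"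
  using assms
proof (induction E arbitrary: U M rule: finite_induct)
  case empty
  then have "U \<noteq> {}" by auto
  then show ?case by (intro exI[of _ "\<lambda>_. 1"]) auto
next
  case (insert e E)
  show ?case
  proof (cases "\<forall>u\<in>U. M e u = 0")
    case True
    have "\<exists>c. (\<exists>u\<in>U. c u \<noteq> 0) \<and> (\<forall>e\<in>E. (\<Sum>u\<in>U. c u * M e u) = 0)"
      using insert.IH[of U M] insert.prems insert.hyps by simp
    then show ?thesis using True by auto
  next
    case False
    then obtain u0 where u0: "u0 \<in> U" "M e u0 \<noteq> 0" by auto
    \<comment> \<open>The coefficients after eliminating \<open>u0\<close> by means of equation
      \<open>e\<close>; the value \<open>- t\<close> at \<open>u0\<close> below restores that
      equation.\<close>
    define M' where "M' = (\<lambda>e' u. M e' u - M e' u0 * M e u / M e u0)"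
    have "card E < card (U - {u0})" using insert.prems insert.hyps u0 by simp
    then obtain c where c: "\<exists>u\<in>U - {u0}. c u \<noteq> 0"
      "\<forall>e'\<in>E. (\<Sum>u\<in>U - {u0}. c u * M' e' u) = 0"
      using insert.IH[of "U - {u0}" M'] insert.prems by auto
    define t where "t = (\<Sum>u\<in>U - {u0}. c u * M e u) / M e u0"
    define c' where "c' = c(u0 := - t)"
    have sum': "(\<Sum>u\<in>U. c' u * M e' u) = (\<Sum>u\<in>U - {u0}. c u * M e' u) - t * M e' u0" for e'
    proof -
      have "(\<Sum>u\<in>U - {u0}. c' u * M e' u) = (\<Sum>u\<in>U - {u0}. c u * M e' u)"
        by (intro sum.cong) (auto simp: c'_def)
      then show ?thesis
        using sum.remove[OF insert.prems(1) u0(1), of "\<lambda>u. c' u * M e' u"] by (simp add: c'_def)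
    qed
    have "(\<Sum>u\<in>U. c' u * M e' u) = 0" if "e' \<in> insert e E" for e'
    proof (cases "e' = e")
      case True
      then show ?thesis using u0 by (simp add: sum' t_def)
    next
      case False
      then have "(\<Sum>u\<in>U - {u0}. c u * M' e' u) = 0" using c that by auto
      also have "(\<Sum>u\<in>U - {u0}. c u * M' e' u)
          = (\<Sum>u\<in>U - {u0}. c u * M e' u) - (\<Sum>u\<in>U - {u0}. c u * M e u) * (M e' u0 / M e u0)"
        unfolding M'_def sum_distrib_right sum_subtractf[symmetric]
        by (intro sum.cong) (auto simp: algebra_simps)
      finally show ?thesis by (simp add: sum' t_def)
    qed
    moreover have "\<exists>u\<in>U. c' u \<noteq> 0" using c(1) by (auto simp: c'_def)
    ultimately show ?thesis by blast
  qed
qed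

subsection \<open>Unions of increasing sequences\<close>

text \<open>Colours are attached to letters rather than positions, so that a colouring can later
  serve as the source map \<open>p\<close> of a walk.\<close>

definition increasing_colouring :: "nat \<Rightarrow> (nat \<Rightarrow> nat) \<Rightarrow> nat list \<Rightarrow> bool" where
  "increasing_colouring D k w \<longleftrightarrow>
     (\<forall>x\<in>set w. k x < D) \<and> sorted_wrt (\<lambda>x y. k x = k y \<longrightarrow> x < y) w"

definition colourable :: "nat \<Rightarrow> nat list \<Rightarrow> bool" where
  "colourable D w \<longleftrightarrow> (\<exists>k. increasing_colouring D k w)"

lemma colourable_mono: "colourable D w \<Longrightarrow> D \<le> D' \<Longrightarrow> colourable D' w"
  unfolding colourable_def increasing_colouring_def by (meson order_less_le_trans)

text \<open>If the first letters differed, each would occur later in the other word; having the same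
  colour, each would be smaller than the other.\<close>

lemma increasing_colouring_unique:
  fixes w w' :: "nat list" and k :: "nat \<Rightarrow> nat"
  assumes "distinct w" "distinct w'" "set w = set w'" "map k w = map k w'"
    and "sorted_wrt (\<lambda>x y. k x = k y \<longrightarrow> x < y) w" "sorted_wrt (\<lambda>x y. k x = k y \<longrightarrow> x < y) w'"
  shows "w = w'"
  using assms
proof (induction w arbitrary: w')
  case (Cons x w)
  then obtain y v where w': "w' = y # v" by (cases w') auto
  have "x = y"
  proof (rule ccontr)
    assume "x \<noteq> y"
    then have "x \<in> set v" "y \<in> set w" using Cons.prems w' by auto
    then have "x < y" "y < x" using Cons.prems w' by auto
    then show False by simp
  qed
  moreover have "w = v"
    using Cons.prems w' \<open>x = y\<close> by (intro Cons.IH) auto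
  ultimately show ?case using w' by simp
qed simp

text \<open>A word is encoded by two strings of \<open>m\<close> colours, one listing the colours by
  position, the other by letter. By the uniqueness above they determine the word.\<close>

lemma card_colourable_le:
  "card {w \<in> permutations_of_set {..<m}. colourable D w} \<le> D ^ (2 * m)"
proof -
  let ?W = "{w \<in> permutations_of_set {..<m}. colourable D w}"
  let ?L = "{xs. set xs \<subseteq> {..<D} \<and> length xs = m}"
  obtain k where k: "\<And>w. w \<in> ?W \<Longrightarrow> increasing_colouring D (k w) w"
    unfolding colourable_def by (atomize_elim, rule choice) auto
  define F where "F = (\<lambda>w. (map (k w) w, map (k w) [0..<m]))"
  have len: "length w = m" if "w \<in> ?W" for w
    using that by (metis (no_types, lifting) card_lessThan length_finite_permutations_of_set mem_Collect_eq)
  have st: "set w = {..<m}" "distinct w" if "w \<in> ?W" for w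
    using that by (auto simp: permutations_of_set_def)
  have "inj_on F ?W"
  proof (rule inj_onI)
    fix u w assume uw: "u \<in> ?W" "w \<in> ?W" "F u = F w"
    have eq: "k u x = k w x" if "x < m" for x
      using uw(3) that by (auto simp: F_def)
    have srt: "sorted_wrt (\<lambda>x y. k u x = k u y \<longrightarrow> x < y) w"
    proof (rule sorted_wrt_mono_rel[rotated])
      show "sorted_wrt (\<lambda>x y. k w x = k w y \<longrightarrow> x < y) w"
        using k[OF uw(2)] by (simp add: increasing_colouring_def)
    qed (use eq st[OF uw(2)] in auto)
    have "map (k u) u = map (k w) w" using uw(3) by (simp add: F_def)
    also have "\<dots> = map (k u) w" using eq st[OF uw(2)] by auto
    finally have col: "map (k u) u = map (k u) w" .
    have "sorted_wrt (\<lambda>x y. k u x = k u y \<longrightarrow> x < y) u"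
      using k[OF uw(1)] by (simp add: increasing_colouring_def)
    then show "u = w"
      using st[OF uw(1)] st[OF uw(2)] srt col
      by (intro increasing_colouring_unique[of u w "k u"]) simp_all
  qed
  moreover have "F ` ?W \<subseteq> ?L \<times> ?L"
  proof (rule image_subsetI)
    fix w assume w: "w \<in> ?W"
    have "\<forall>x<m. k w x < D" using k[OF w] st[OF w] by (auto simp: increasing_colouring_def)
    then show "F w \<in> ?L \<times> ?L" using st[OF w] len[OF w] by (auto simp: F_def)
  qed
  moreover have fin: "finite ?L" by (rule finite_lists_length_eq) simp
  ultimately have "card ?W \<le> card (?L \<times> ?L)"
    by (intro card_inj_on_le[of F]) auto
  also have "\<dots> = D ^ m * D ^ m"
    using card_lists_length_eq[of "{..<D}" m] by (simp add: card_cartesian_product)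
  also have "\<dots> = D ^ (2 * m)" by (simp add: mult_2 power_add)
  finally show ?thesis .
qed

text \<open>The greedy colouring: a letter gets as colour the length, less one, of some decreasing
  subsequence that starts with it.\<close>

lemma greedy_colouring:
  fixes w :: "nat list"
  assumes "distinct w"
  shows "\<exists>k. sorted_wrt (\<lambda>x y. k x = k y \<longrightarrow> x < y) w \<and>
    (\<forall>x\<in>set w. \<exists>u. length u = k x \<and> sorted_wrt (>) (x # u) \<and> subseq (x # u) w)"
  using assms
proof (induction w)
  case (Cons x w)
  then obtain k where k: "sorted_wrt (\<lambda>x y. k x = k y \<longrightarrow> x < y) w"
    "\<And>y. y \<in> set w \<Longrightarrow> \<exists>u. length u = k y \<and> sorted_wrt (>) (y # u) \<and> subseq (y # u) w"
    by auto
  have x: "x \<notin> set w" using Cons.prems by simp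
  define S where "S = {y \<in> set w. y < x}"
  have fin: "finite S" by (simp add: S_def)
  \<comment> \<open>Exceeding the colours of all smaller later letters keeps the colouring
    increasing. A letter that attains the maximum has a decreasing subsequence that \<open>x\<close>
    prolongs by one.\<close>
  define c where "c = (if S = {} then 0 else Suc (Max (k ` S)))"
  have less: "k y < c" if "y \<in> set w" "y < x" for y
  proof -
    have "y \<in> S" using that by (simp add: S_def)
    then have "k y \<le> Max (k ` S)" using fin by simp
    then show ?thesis using \<open>y \<in> S\<close> by (auto simp: c_def)
  qed
  have sub: "\<exists>u. length u = c \<and> sorted_wrt (>) (x # u) \<and> subseq (x # u) (x # w)"
  proof (cases "S = {}")
    case True
    then show ?thesis by (intro exI[of _ "[]"]) (simp add: c_def)
  next
    case False
    then have "Max (k ` S) \<in> k ` S" using fin by simp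
    then obtain y where y: "y \<in> set w" "y < x" "Max (k ` S) = k y" by (auto simp: S_def)
    then obtain u where "length u = k y" "sorted_wrt (>) (y # u)" "subseq (y # u) w"
      using k(2) by blast
    moreover from this have "\<forall>z\<in>set (y # u). z < x" using y(2) by auto
    ultimately show ?thesis using y False by (intro exI[of _ "y # u"]) (auto simp: c_def)
  qed
  let ?k = "k(x := c)"
  have "sorted_wrt (\<lambda>a b. ?k a = ?k b \<longrightarrow> a < b) (x # w)"
  proof -
    have "sorted_wrt (\<lambda>a b. ?k a = ?k b \<longrightarrow> a < b) w"
      using k(1) by (rule sorted_wrt_mono_rel[rotated]) (use x in auto)
    moreover have "x < y" if "y \<in> set w" "c = k y" for y
      using that less[of y] x by (metis linorder_neqE_nat order_less_irrefl)
    ultimately show ?thesis using x by auto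
  qed
  moreover have "\<exists>u. length u = ?k y \<and> sorted_wrt (>) (y # u) \<and> subseq (y # u) (x # w)"
    if "y \<in> set (x # w)" for y
  proof (cases "y = x")
    case True
    then show ?thesis using sub by simp
  next
    case False
    then have "y \<in> set w" using that by simp
    then show ?thesis using k(2)[of y] False by (metis fun_upd_other list_emb_Cons)
  qed
  ultimately show ?case by blast
qed auto

text \<open>The greedy colouring must use a colour of at least \<open>D\<close>; its letter starts a
  decreasing subsequence of more than \<open>D\<close> letters, which is cut to length
  \<open>Suc D\<close>.\<close>

lemma not_colourable_imp_decreasing:
  assumes "distinct w" "\<not> colourable D w"
  shows "\<exists>u. length u = Suc D \<and> sorted_wrt (>) u \<and> subseq u w"
proof -
  obtain k where k: "sorted_wrt (\<lambda>x y. k x = k y \<longrightarrow> x < y) w"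
    "\<And>x. x \<in> set w \<Longrightarrow> \<exists>u. length u = k x \<and> sorted_wrt (>) (x # u) \<and> subseq (x # u) w"
    using greedy_colouring[OF assms(1)] by blast
  moreover have "\<not> increasing_colouring D k w" using assms(2) by (auto simp: colourable_def)
  ultimately obtain x where x: "x \<in> set w" "\<not> k x < D"
    by (auto simp: increasing_colouring_def)
  obtain u where u: "length u = k x" "sorted_wrt (>) (x # u)" "subseq (x # u) w"
    using k(2)[OF x(1)] by blast
  have "subseq (take (Suc D) (x # u)) w"
    using u(3) by (meson prefix_imp_subseq subseq_order.trans take_is_prefix)
  moreover have "sorted_wrt (>) (take (Suc D) (x # u))"
    using u(2) by (rule sorted_wrt_take)
  ultimately show ?thesis using u(1) x(2)
    by (intro exI[of _ "take (Suc D) (x # u)"]) auto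
qed

text \<open>Cut \<open>w\<close> just before each letter of \<open>u\<close>; \<open>w0\<close> is
  what precedes the first cut. These are the blocks permuted in Latyshev's lemma.\<close>

lemma subseq_block_decomposition:
  "subseq u w \<Longrightarrow> \<exists>w0 bs. w = w0 @ concat bs \<and> [] \<notin> set bs \<and> map hd bs = u"
proof (induction rule: list_emb.induct)
  case (list_emb_Nil w)
  show ?case by (intro exI[of _ w] exI[of _ "[]"]) simp
next
  case (list_emb_Cons u w x)
  then obtain w0 bs where "w = w0 @ concat bs \<and> [] \<notin> set bs \<and> map hd bs = u" by blast
  then show ?case by (intro exI[of _ "x # w0"] exI[of _ bs]) simp
next
  case (list_emb_Cons2 x y u w)
  then obtain w0 bs where "w = w0 @ concat bs \<and> [] \<notin> set bs \<and> map hd bs = u" by blast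
  then show ?case using list_emb_Cons2 by (intro exI[of _ "[]"] exI[of _ "(y # w0) # bs"]) simp
qed

text \<open>Pairs are coded in this way both for the points of a block grid and for the indices of
  matrices whose entries are matrices.\<close>

lemma mult_add_eq_iff:
  fixes x y k l n :: nat
  assumes "k < n" "l < n"
  shows "x * n + k = y * n + l \<longleftrightarrow> x = y \<and> k = l"
proof
  assume eq: "x * n + k = y * n + l"
  have "(x * n + k) div n = x" "(y * n + l) div n = y" using assms by auto
  then have "x = y" using eq by metis
  then show "x = y \<and> k = l" using eq by simp
qed simp

lemma mult_add_less:
  fixes x k l n :: nat
  assumes "x < l" "k < n"
  shows "x * n + k < l * n"
proof -
  have "x * n + k < Suc x * n" using assms by simp
  also have "\<dots> \<le> l * n" using assms by (intro mult_le_mono1) simp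
  finally show ?thesis .
qed

section \<open>Many permutations with few increasing sequences\<close>

text \<open>Positions and values are cut into \<open>L\<close> blocks of length \<open>L\<close>.
  For permutations \<open>\<rho> i\<close> and \<open>\<tau> j\<close>, the word has one point in
  each cell given by a position block \<open>i\<close> and a value block \<open>j\<close>:
  \<open>\<rho> i\<close> orders the points inside position block \<open>i\<close>, and
  \<open>\<tau> j\<close> those inside value block \<open>j\<close>.\<close>

definition grid_word :: "nat \<Rightarrow> (nat \<Rightarrow> nat \<Rightarrow> nat) \<Rightarrow> (nat \<Rightarrow> nat \<Rightarrow> nat) \<Rightarrow> nat list" where
  "grid_word L \<rho> \<tau> =
     map (\<lambda>n. let i = n div L; j = \<rho> i (n mod L) in j * L + \<tau> j i) [0..<L * L]"

text \<open>The \<open>2 * L\<close> permutations of a grid word are arbitrary and can be read off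
  from it, which gives the count; the \<open>2 * L - 1\<close> diagonals of the grid serve as
  colours.\<close>

lemma card_colourable_ge:
  "fact L ^ (2 * L) \<le> card {w \<in> permutations_of_set {..<L * L}. colourable (2 * L) w}"
proof -
  let ?W = "{w \<in> permutations_of_set {..<L * L}. colourable (2 * L) w}"
  let ?P = "PiE {..<L} (\<lambda>_. {\<pi>. \<pi> permutes {..<L}})"
  let ?\<sigma> = "\<lambda>\<rho> \<tau> n. let i = n div L; j = \<rho> i (n mod L) in j * L + \<tau> j i"
  have perm: "f i permutes {..<L}" if "f \<in> ?P" "i < L" for f i
    using that by (auto simp: PiE_def Pi_def)
  have lt: "f i t < L" if "f \<in> ?P" "i < L" "t < L" for f i t
    using permutes_in_image[OF perm[OF that(1,2)], of t] that(3) by simp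
  have inj: "f i t = f i t' \<longleftrightarrow> t = t'" if "f \<in> ?P" "i < L" for f i t t'
    using permutes_inj[OF perm[OF that]] by (auto dest: injD)
  have dm: "n div L < L" "n mod L < L" if "n < L * L" for n
  proof -
    have "0 < L" using that by (cases L) auto
    then show "n div L < L" "n mod L < L" using that by (auto simp: less_mult_imp_div_less)
  qed
  have \<sigma>_inj: "inj_on (?\<sigma> \<rho> \<tau>) {..<L * L}" if \<rho>: "\<rho> \<in> ?P" and \<tau>: "\<tau> \<in> ?P" for \<rho> \<tau>
  proof (rule inj_onI)
    fix n n' assume n: "n \<in> {..<L * L}" "n' \<in> {..<L * L}" "?\<sigma> \<rho> \<tau> n = ?\<sigma> \<rho> \<tau> n'"
    then have d: "n div L < L" "n mod L < L" "n' div L < L" "n' mod L < L" using dm by auto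
    have j: "\<rho> (n div L) (n mod L) = \<rho> (n' div L) (n' mod L)"
      and "\<tau> (\<rho> (n div L) (n mod L)) (n div L) = \<tau> (\<rho> (n' div L) (n' mod L)) (n' div L)"
      using n(3) d by (auto simp: Let_def mult_add_eq_iff lt[OF \<rho>] lt[OF \<tau>])
    then have "n div L = n' div L" using inj[OF \<tau>] lt[OF \<rho>] d by metis
    moreover from this have "n mod L = n' mod L" using j inj[OF \<rho>] d by metis
    ultimately show "n = n'" by (metis div_mult_mod_eq)
  qed
  have \<sigma>_img: "?\<sigma> \<rho> \<tau> ` {..<L * L} \<subseteq> {..<L * L}" if \<rho>: "\<rho> \<in> ?P" and \<tau>: "\<tau> \<in> ?P" for \<rho> \<tau>
    using dm by (auto simp: Let_def intro!: mult_add_less lt[OF \<rho>] lt[OF \<tau>])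
  have in_perms: "grid_word L \<rho> \<tau> \<in> permutations_of_set {..<L * L}" if "\<rho> \<in> ?P" "\<tau> \<in> ?P" for \<rho> \<tau>
  proof -
    have "?\<sigma> \<rho> \<tau> ` {..<L * L} = {..<L * L}"
      using endo_inj_surj[OF _ \<sigma>_img[OF that] \<sigma>_inj[OF that]] by simp
    then show ?thesis
      using \<sigma>_inj[OF that]
      by (simp add: permutations_of_set_def grid_word_def distinct_map atLeast0LessThan)
  qed
  \<comment> \<open>The position \<open>i * L + t\<close> carries a value in block \<open>j = \<rho> i t\<close>. Along a diagonal
    \<open>j - i = const\<close> of the grid of blocks the values increase.\<close>
  have col: "colourable (2 * L) (grid_word L \<rho> \<tau>)" if \<rho>: "\<rho> \<in> ?P" and \<tau>: "\<tau> \<in> ?P" for \<rho> \<tau>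
  proof -
    \<comment> \<open>This is \<open>j - i\<close>, shifted by \<open>L\<close> to stay within the
      naturals. The letter \<open>y\<close> determines \<open>j\<close> as its block and then
      \<open>i\<close> as the preimage of its offset under \<open>\<tau> j\<close>.\<close>
    define k where "k = (\<lambda>y. y div L + (L - inv (\<tau> (y div L)) (y mod L)))"
    have k: "k (?\<sigma> \<rho> \<tau> n) = \<rho> (n div L) (n mod L) + (L - n div L)" if "n < L * L" for n
    proof -
      let ?i = "n div L" let ?j = "\<rho> ?i (n mod L)"
      have "?j < L" "\<tau> ?j ?i < L" using dm[OF that] by (auto intro!: lt[OF \<rho>] lt[OF \<tau>])
      moreover have "inv (\<tau> ?j) (\<tau> ?j ?i) = ?i"
        using permutes_inverses(2)[OF perm[OF \<tau> \<open>?j < L\<close>]] .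
      ultimately show ?thesis by (simp add: k_def Let_def)
    qed
    have "sorted_wrt (\<lambda>n n'. k (?\<sigma> \<rho> \<tau> n) = k (?\<sigma> \<rho> \<tau> n') \<longrightarrow> ?\<sigma> \<rho> \<tau> n < ?\<sigma> \<rho> \<tau> n') [0..<L * L]"
    proof (rule sorted_wrt_mono_rel[of _ "(<)"])
      fix n n' assume "n \<in> set [0..<L * L]" "n' \<in> set [0..<L * L]" and less: "n < n'"
      then have n: "n < L * L" "n' < L * L" by auto
      let ?i = "n div L" let ?j = "\<rho> ?i (n mod L)"
      let ?i' = "n' div L" let ?j' = "\<rho> ?i' (n' mod L)"
      show "k (?\<sigma> \<rho> \<tau> n) = k (?\<sigma> \<rho> \<tau> n') \<longrightarrow> ?\<sigma> \<rho> \<tau> n < ?\<sigma> \<rho> \<tau> n'"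
      proof
        assume "k (?\<sigma> \<rho> \<tau> n) = k (?\<sigma> \<rho> \<tau> n')"
        then have eq: "?j + (L - ?i) = ?j' + (L - ?i')" by (simp only: k n)
        have "?i \<le> ?i'" using less by (simp add: div_le_mono)
        moreover have "?i \<noteq> ?i'"
        proof
          assume i: "?i = ?i'"
          then have "?j = ?j'" using eq by simp
          then have "n mod L = n' mod L" using inj[OF \<rho> dm(1)[OF n(1)]] i by simp
          then show False using i less by (metis div_mult_mod_eq order_less_irrefl)
        qed
        ultimately have "?j < ?j'" using eq dm(1)[OF n(1)] dm(1)[OF n(2)] by linarith
        have "?j < L" using dm[OF n(1)] by (intro lt[OF \<rho>])
        then have "\<tau> ?j ?i < L" using dm[OF n(1)] by (intro lt[OF \<tau>])
        then have "?\<sigma> \<rho> \<tau> n < Suc ?j * L" by (simp add: Let_def)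
        also have "\<dots> \<le> ?j' * L" using \<open>?j < ?j'\<close> by (intro mult_le_mono1) simp
        also have "\<dots> \<le> ?\<sigma> \<rho> \<tau> n'" by (simp add: Let_def)
        finally show "?\<sigma> \<rho> \<tau> n < ?\<sigma> \<rho> \<tau> n'" .
      qed
    qed simp
    moreover have "k (?\<sigma> \<rho> \<tau> n) < 2 * L" if "n < L * L" for n
    proof -
      have "\<rho> (n div L) (n mod L) < L" using dm[OF that] by (intro lt[OF \<rho>])
      then show ?thesis using k[OF that] by linarith
    qed
    ultimately have "increasing_colouring (2 * L) k (grid_word L \<rho> \<tau>)"
      by (simp add: increasing_colouring_def grid_word_def sorted_wrt_map)
    then show ?thesis by (auto simp: colourable_def)
  qed
  have "inj_on (\<lambda>(\<rho>, \<tau>). grid_word L \<rho> \<tau>) (?P \<times> ?P)"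
  proof (rule inj_onI, clarify)
    fix \<rho> \<tau> \<rho>' \<tau>' assume P: "\<rho> \<in> ?P" "\<tau> \<in> ?P" "\<rho>' \<in> ?P" "\<tau>' \<in> ?P"
      and eq: "grid_word L \<rho> \<tau> = grid_word L \<rho>' \<tau>'"
    have \<sigma>: "?\<sigma> \<rho> \<tau> n = ?\<sigma> \<rho>' \<tau>' n" if "n < L * L" for n
      using eq that by (auto simp: grid_word_def)
    have *: "\<rho> i t = \<rho>' i t \<and> \<tau> (\<rho> i t) i = \<tau>' (\<rho>' i t) i" if "i < L" "t < L" for i t
    proof -
      have "(i * L + t) div L = i" "(i * L + t) mod L = t" using that by auto
      then show ?thesis using \<sigma>[OF mult_add_less[OF that]] that by (auto simp: Let_def mult_add_eq_iff lt[OF P(1)] lt[OF P(2)] lt[OF P(3)] lt[OF P(4)])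
    qed
    have "\<rho> i = \<rho>' i" if "i < L" for i
    proof
      fix t show "\<rho> i t = \<rho>' i t"
        using *[OF that, of t] permutes_not_in[OF perm[OF P(1) that], of t]
          permutes_not_in[OF perm[OF P(3) that], of t] by (cases "t < L") simp_all
    qed
    then have \<rho>: "\<rho> = \<rho>'" by (intro PiE_ext[OF P(1,3)]) simp
    have "\<tau> j = \<tau>' j" if "j < L" for j
    proof
      fix i show "\<tau> j i = \<tau>' j i"
      proof (cases "i < L")
        case True
        \<comment> \<open>As \<open>\<rho> i\<close> is onto, every offset \<open>\<tau> j i\<close>
          shows up in the word and can be compared.\<close>
        have "j \<in> \<rho> i ` {..<L}" using permutes_image[OF perm[OF P(1) True]] that by simp
        then obtain t where "t < L" "j = \<rho> i t" by auto
        then show ?thesis using *[OF True, of t] \<rho> by simp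
      next
        case False
        then show ?thesis
          using permutes_not_in[OF perm[OF P(2) that], of i]
            permutes_not_in[OF perm[OF P(4) that], of i] by simp
      qed
    qed
    then have "\<tau> = \<tau>'" by (intro PiE_ext[OF P(2,4)]) simp
    then show "\<rho> = \<rho>' \<and> \<tau> = \<tau>'" using \<rho> by simp
  qed
  moreover have "(\<lambda>(\<rho>, \<tau>). grid_word L \<rho> \<tau>) ` (?P \<times> ?P) \<subseteq> ?W"
    using in_perms col by (intro image_subsetI) (simp add: split_beta mem_Times_iff)
  ultimately have "card (?P \<times> ?P) \<le> card ?W"
    by (rule card_inj_on_le) simp
  moreover have "card (?P \<times> ?P) = fact L ^ (2 * L)"
    by (simp add: card_cartesian_product card_PiE card_permutations mult_2 power_add)
  ultimately show ?thesis by simp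
qed

subsection \<open>Evaluation of words\<close>

context assoc_algebra
begin

lemma scale_zero_left: "x \<in> alg_carrier A \<Longrightarrow> alg_scale A 0 x = 0"
  using scale_left_distrib[of x 0 0] by simp

lemma scale_sum_left:
  "x \<in> alg_carrier A \<Longrightarrow> alg_scale A (sum f I) x = (\<Sum>i\<in>I. alg_scale A (f i) x)"
  by (induction I rule: infinite_finite_induct) (auto simp: scale_zero_left scale_left_distrib)

end

lemma eval_word_Cons: "w \<noteq> [] \<Longrightarrow> eval_word A v (i # w) = alg_mult A (v i) (eval_word A v w)"
  by (cases w) auto

lemma eval_word_cong:
  "(\<And>i. i \<in> set w \<Longrightarrow> v i = v' i) \<Longrightarrow> eval_word A v w = eval_word A v' w"
  by (induction A v w rule: eval_word.induct) auto

lemma eval_word_map: "eval_word A v (map f w) = eval_word A (\<lambda>i. v (f i)) w"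
  by (induction A "\<lambda>i. v (f i)" w rule: eval_word.induct) auto

context assoc_algebra
begin

lemma eval_word_closed:
  "(\<And>i. i \<in> set w \<Longrightarrow> v i \<in> alg_carrier A) \<Longrightarrow> eval_word A v w \<in> alg_carrier A"
proof (induction w)
  case (Cons i w)
  then show ?case by (cases "w = []") (auto simp: eval_word_Cons mult_closed)
qed (simp add: zero_closed)

lemma eval_word_append:
  assumes "u \<noteq> []" "w \<noteq> []" "\<And>i. i \<in> set u \<union> set w \<Longrightarrow> v i \<in> alg_carrier A"
  shows "eval_word A v (u @ w) = alg_mult A (eval_word A v u) (eval_word A v w)"
  using assms
proof (induction u)
  case (Cons i u)
  show ?case
  proof (cases "u = []")
    case True
    then show ?thesis using Cons.prems by (simp add: eval_word_Cons)
  next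
    case False
    then show ?thesis using Cons by (simp add: eval_word_Cons mult_assoc eval_word_closed)
  qed
qed simp

lemma eval_word_concat_map:
  assumes "\<And>j. j \<in> set u \<Longrightarrow> b j \<noteq> []" "\<And>i. v i \<in> alg_carrier A"
  shows "eval_word A v (concat (map b u)) = eval_word A (\<lambda>j. eval_word A v (b j)) u"
  using assms(1)
proof (induction u)
  case (Cons j u)
  show ?case
  proof (cases "u = []")
    case False
    then have "concat (map b u) \<noteq> []" using Cons.prems by (cases u) auto
    then show ?thesis using Cons False assms(2) by (simp add: eval_word_Cons eval_word_append)
  qed simp
qed simp

text \<open>The letter \<open>x\<close> occurs exactly once in \<open>w\<close>, so the product is
  additive in its value. Multilinearity of \<open>multi_eval\<close> comes from here.\<close>

lemma eval_word_update_sum: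
  assumes "distinct w" "x \<in> set w" "\<And>i. v i \<in> alg_carrier A" "\<And>s. s \<in> S \<Longrightarrow> f s \<in> alg_carrier A"
  shows "eval_word A (v(x := sum f S)) w = (\<Sum>s\<in>S. eval_word A (v(x := f s)) w)"
  using assms(1,2)
proof (induction w)
  case (Cons i w)
  show ?case
  proof (cases "w = []")
    case False
    have cl: "eval_word A v w \<in> alg_carrier A" "\<And>s. s \<in> S \<Longrightarrow> eval_word A (v(x := f s)) w \<in> alg_carrier A"
      using assms by (auto intro!: eval_word_closed)
    show ?thesis
    proof (cases "i = x")
      case True
      then have "eval_word A (v(x := y)) w = eval_word A v w" for y
        using Cons.prems by (intro eval_word_cong) auto
      then show ?thesis using True False cl assms
        by (simp add: eval_word_Cons mult_sum_left del: fun_upd_apply) (simp add: mult_sum_left)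
    next
      case neq: False
      have "eval_word A (v(x := y)) (i # w) = alg_mult A (v i) (eval_word A (v(x := y)) w)" for y
        using False neq by (simp add: eval_word_Cons)
      moreover have "eval_word A (v(x := sum f S)) w = (\<Sum>s\<in>S. eval_word A (v(x := f s)) w)"
        using Cons.IH Cons.prems neq by (auto simp del: fun_upd_apply)
      ultimately show ?thesis using cl assms(3) by (simp add: mult_sum_right del: fun_upd_apply)
    qed
  qed (use Cons in simp)
qed simp

lemma eval_poly_superset:
  assumes "finite K" "Poly_Mapping.keys f \<subseteq> K" "\<And>i. v i \<in> alg_carrier A"
  shows "eval_poly A v f = (\<Sum>w\<in>K. alg_scale A (Poly_Mapping.lookup f w) (eval_word A v w))"
  unfolding eval_poly_def using assms
  by (intro sum.mono_neutral_left)
    (auto simp: in_keys_iff scale_zero_left eval_word_closed)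

lemma subspace_identities: "ncpoly.subspace (identities A)"
proof (rule ncpoly.subspaceI)
  show "0 \<in> identities A" by (simp add: identities_def free_alg_def eval_poly_def)
next
  fix f g assume fg: "f \<in> identities A" "g \<in> identities A"
  let ?K = "Poly_Mapping.keys f \<union> Poly_Mapping.keys g"
  have "eval_poly A v (f + g) = eval_poly A v f + eval_poly A v g"
    if "\<And>i. v i \<in> alg_carrier A" for v
  proof -
    have K: "finite ?K" "Poly_Mapping.keys (f + g) \<subseteq> ?K" "Poly_Mapping.keys f \<subseteq> ?K"
      "Poly_Mapping.keys g \<subseteq> ?K" using Poly_Mapping.keys_add[of f g] by auto
    show ?thesis
      unfolding eval_poly_superset[OF K(1,2) that] eval_poly_superset[OF K(1,3) that]
        eval_poly_superset[OF K(1,4) that] sum.distrib[symmetric]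
      by (intro sum.cong) (auto simp: lookup_add scale_left_distrib eval_word_closed that)
  qed
  then show "f + g \<in> identities A"
    using fg by (simp add: identities_def free_alg_def lookup_add)
next
  fix c f assume f: "f \<in> identities A"
  have "eval_poly A v (ncpoly_scale c f) = alg_scale A c (eval_poly A v f)"
    if "\<And>i. v i \<in> alg_carrier A" for v
  proof -
    have K: "finite (Poly_Mapping.keys f)" "Poly_Mapping.keys (ncpoly_scale c f) \<subseteq> Poly_Mapping.keys f"
      by (auto simp: in_keys_iff)
    show ?thesis
      unfolding eval_poly_superset[OF K that]
      by (simp add: eval_poly_def scale_sum scale_scale scale_closed eval_word_closed that)
  qed
  then show "ncpoly_scale c f \<in> identities A"
    using f by (simp add: identities_def free_alg_def scale_zero_right)
qed

end

text \<open>A multilinear polynomial of degree \<open>m\<close> is given by a coefficient for each of the words in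
  \<^term>\<open>permutations_of_set {..<m}\<close>.\<close>

definition multi_eval ::
    "('k::field, 'a::ab_group_add) alg \<Rightarrow> nat \<Rightarrow> (nat list \<Rightarrow> 'k) \<Rightarrow> (nat \<Rightarrow> 'a) \<Rightarrow> 'a" where
  "multi_eval A m c v =
     (\<Sum>w\<in>permutations_of_set {..<m}. alg_scale A (c w) (eval_word A v w))"

definition multi_identity ::
    "('k::field, 'a::ab_group_add) alg \<Rightarrow> nat \<Rightarrow> (nat list \<Rightarrow> 'k) \<Rightarrow> bool" where
  "multi_identity A m c \<longleftrightarrow> (\<forall>v. (\<forall>i. v i \<in> alg_carrier A) \<longrightarrow> multi_eval A m c v = 0)"

definition multi_poly :: "nat \<Rightarrow> (nat list \<Rightarrow> 'k::field) \<Rightarrow> 'k ncpoly" where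
  "multi_poly m c = (\<Sum>w\<in>permutations_of_set {..<m}. Poly_Mapping.single w (c w))"

lemma perm_lessThanD:
  assumes "w \<in> permutations_of_set {..<m::nat}"
  shows "set w = {..<m}" "distinct w" "length w = m" "0 < m \<Longrightarrow> w \<noteq> []"
  using assms length_finite_permutations_of_set[OF assms]
  by (auto simp: permutations_of_set_def)

lemma multi_eval_cong:
  assumes "\<And>i. i < m \<Longrightarrow> v i = v' i"
  shows "multi_eval A m c v = multi_eval A m c v'"
  unfolding multi_eval_def using assms
  by (intro sum.cong refl arg_cong[where f = "alg_scale A _"] eval_word_cong)
    (auto dest: perm_lessThanD(1))

lemma lookup_multi_poly:
  "Poly_Mapping.lookup (multi_poly m c) w = (c w when w \<in> permutations_of_set {..<m})"
proof -
  have "Poly_Mapping.lookup (multi_poly m c) w =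
      (\<Sum>u\<in>permutations_of_set {..<m}. if u = w then c u else 0)"
    by (simp add: multi_poly_def lookup_sum lookup_single when_def)
  then show ?thesis by (simp add: when_def)
qed

context assoc_algebra
begin

lemma multi_poly_identity_iff:
  assumes "0 < m"
  shows "multi_poly m c \<in> identities A \<longleftrightarrow> multi_identity A m c"
proof -
  have "eval_poly A v (multi_poly m c) = multi_eval A m c v" if "\<forall>i. v i \<in> alg_carrier A" for v
  proof -
    have "Poly_Mapping.keys (multi_poly m c) \<subseteq> permutations_of_set {..<m}"
      by (auto simp: in_keys_iff lookup_multi_poly)
    then show ?thesis using that
      by (subst eval_poly_superset[where K = "permutations_of_set {..<m}"])
        (auto simp: multi_eval_def lookup_multi_poly)
  qed
  moreover have "multi_poly m c \<in> free_alg"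
    using assms perm_lessThanD(4)[of "[]" m] by (auto simp: free_alg_def lookup_multi_poly when_def)
  ultimately show ?thesis by (auto simp: identities_def multi_identity_def)
qed

lemma multi_eval_update_sum:
  assumes "x < m" "\<And>i. v i \<in> alg_carrier A" "\<And>s. s \<in> S \<Longrightarrow> f s \<in> alg_carrier A"
  shows "multi_eval A m c (v(x := sum f S)) = (\<Sum>s\<in>S. multi_eval A m c (v(x := f s)))"
proof -
  have "multi_eval A m c (v(x := sum f S)) =
      (\<Sum>w\<in>permutations_of_set {..<m}. \<Sum>s\<in>S. alg_scale A (c w) (eval_word A (v(x := f s)) w))"
    unfolding multi_eval_def
  proof (intro sum.cong refl)
    fix w assume w: "w \<in> permutations_of_set {..<m}"
    have "eval_word A (v(x := sum f S)) w = (\<Sum>s\<in>S. eval_word A (v(x := f s)) w)"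
      using perm_lessThanD[OF w] assms by (intro eval_word_update_sum) auto
    then show "alg_scale A (c w) (eval_word A (v(x := sum f S)) w) =
        (\<Sum>s\<in>S. alg_scale A (c w) (eval_word A (v(x := f s)) w))"
      using assms by (simp add: scale_sum eval_word_closed)
  qed
  also have "\<dots> = (\<Sum>s\<in>S. multi_eval A m c (v(x := f s)))"
    unfolding multi_eval_def by (rule sum.swap)
  finally show ?thesis .
qed

section \<open>Multilinear identities from arbitrary ones\<close>

text \<open>Expanding the product of sums amounts to choosing, at each position of \<open>t\<close>,
  one element of the fibre over its letter.\<close>

lemma eval_word_fibre_sum:
  assumes "finite S" "\<And>i. v i \<in> alg_carrier A"
  shows "eval_word A (\<lambda>i. \<Sum>j\<in>{j \<in> S. g j = i}. v j) t =
    (\<Sum>js\<in>{js. set js \<subseteq> S \<and> map g js = t}. eval_word A v js)"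
proof (induction t)
  case (Cons i t)
  show ?case
  proof (cases "t = []")
    case True
    have eq: "{js. set js \<subseteq> S \<and> map g js = i # t} = (\<lambda>j. [j]) ` {j \<in> S. g j = i}"
      using True by auto
    show ?thesis unfolding eq by (subst sum.reindex) (auto simp: True inj_on_def)
  next
    case False
    let ?J = "{j \<in> S. g j = i}" and ?L = "{js. set js \<subseteq> S \<and> map g js = t}"
    have eq: "{js. set js \<subseteq> S \<and> map g js = i # t} = (\<lambda>(j, js). j # js) ` (?J \<times> ?L)"
      by (auto simp: image_iff Cons_eq_map_conv map_eq_Cons_conv)
    have cl: "eval_word A v js \<in> alg_carrier A" for js using assms(2) by (rule eval_word_closed)
    have "eval_word A (\<lambda>i. \<Sum>j\<in>{j \<in> S. g j = i}. v j) (i # t) =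
        alg_mult A (\<Sum>j\<in>?J. v j) (\<Sum>js\<in>?L. eval_word A v js)"
      using False Cons.IH by (simp add: eval_word_Cons)
    also have "\<dots> = (\<Sum>j\<in>?J. alg_mult A (v j) (\<Sum>js\<in>?L. eval_word A v js))"
      by (intro mult_sum_left sum_closed assms cl)
    also have "\<dots> = (\<Sum>j\<in>?J. \<Sum>js\<in>?L. alg_mult A (v j) (eval_word A v js))"
      by (intro sum.cong refl mult_sum_right assms cl)
    also have "\<dots> = (\<Sum>j\<in>?J. \<Sum>js\<in>?L. eval_word A v (j # js))"
      using False by (intro sum.cong refl eval_word_Cons[symmetric]) auto
    also have "\<dots> = (\<Sum>js\<in>{js. set js \<subseteq> S \<and> map g js = i # t}. eval_word A v js)"
      unfolding eq by (subst sum.reindex) (auto simp: inj_on_def sum.cartesian_product split_beta)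
    finally show ?thesis .
  qed
qed simp

text \<open>Let \<open>w\<close> be a longest word of \<open>f\<close>, of length \<open>d\<close>. Replacing the letters \<open>i\<close> of \<open>f\<close> by the sums of
  the new variables at the positions of \<open>i\<close> in \<open>w\<close>, the part of the result that involves all \<open>d\<close> new
  variables is multilinear.\<close>

lemma multi_identity_exists:
  assumes f: "f \<in> identities A" "f \<noteq> 0"
  shows "\<exists>d \<gamma>. 0 < d \<and> \<gamma> [0..<d] \<noteq> 0 \<and> multi_identity A d \<gamma>"
proof -
  let ?K = "Poly_Mapping.keys f"
  have fin: "finite ?K" and ne: "?K \<noteq> {}" using f(2) by auto
  have "Max (length ` ?K) \<in> length ` ?K" using fin ne by simp
  then obtain w where "w \<in> ?K" "length w = Max (length ` ?K)" by auto
  then have w: "w \<in> ?K" "\<And>u. u \<in> ?K \<Longrightarrow> length u \<le> length w" using fin by auto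
  define d where "d = length w"
  have "Poly_Mapping.lookup f [] = 0" using f(1) by (simp add: identities_def free_alg_def)
  then have "w \<noteq> []" using w(1) by (auto simp: in_keys_iff)
  \<comment> \<open>The coefficient in \<open>f\<close> of the word that arises from
    \<open>u\<close> when positions of \<open>w\<close> are replaced by their letters; at
    \<open>[0..<d]\<close> it is the coefficient of \<open>w\<close> itself.\<close>
  define \<gamma> where "\<gamma> = (\<lambda>u. Poly_Mapping.lookup f (map ((!) w) u))"
  have "multi_identity A d \<gamma>"
    unfolding multi_identity_def
  proof (intro allI impI)
    fix v :: "nat \<Rightarrow> 'a" assume "\<forall>i. v i \<in> alg_carrier A"
    then have v: "\<And>i. v i \<in> alg_carrier A" by simp
    have cl: "eval_word A v js \<in> alg_carrier A" for js using v by (rule eval_word_closed)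
    \<comment> \<open>\<open>H T\<close> collects the terms of the expanded \<open>f\<close> in
      which exactly the new variables in \<open>T\<close> occur.\<close>
    define H where "H = (\<lambda>T. \<Sum>t\<in>?K. alg_scale A (Poly_Mapping.lookup f t)
        (\<Sum>js\<in>{js. set js = T \<and> map ((!) w) js = t}. eval_word A v js))"
    have fin_js: "finite {js. set js \<subseteq> S \<and> map ((!) w) js = t}" if "finite S" for S t
      by (rule finite_subset[OF _ finite_lists_length_eq[OF that, of "length t"]]) auto
    have sum_H: "(\<Sum>T\<in>Pow S. H T) = 0" if S: "finite S" for S
    proof -
      have "(\<Sum>T\<in>Pow S. H T) = (\<Sum>t\<in>?K. \<Sum>T\<in>Pow S. alg_scale A (Poly_Mapping.lookup f t)
          (\<Sum>js\<in>{js. set js = T \<and> map ((!) w) js = t}. eval_word A v js))"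
        unfolding H_def by (rule sum.swap)
      also have "\<dots> = (\<Sum>t\<in>?K. alg_scale A (Poly_Mapping.lookup f t)
          (\<Sum>T\<in>Pow S. \<Sum>js\<in>{js. set js = T \<and> map ((!) w) js = t}. eval_word A v js))"
        by (intro sum.cong refl scale_sum[symmetric] sum_closed cl)
      also have "\<dots> = (\<Sum>t\<in>?K. alg_scale A (Poly_Mapping.lookup f t)
          (eval_word A (\<lambda>i. \<Sum>j\<in>{j \<in> S. w ! j = i}. v j) t))"
      proof (intro sum.cong refl arg_cong[where f = "alg_scale A _"])
        fix t
        let ?L = "{js. set js \<subseteq> S \<and> map ((!) w) js = t}"
        have "(\<Sum>T\<in>Pow S. \<Sum>js\<in>{js. set js = T \<and> map ((!) w) js = t}. eval_word A v js) =
            (\<Sum>T\<in>Pow S. \<Sum>js\<in>{js \<in> ?L. set js = T}. eval_word A v js)"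
          by (intro sum.cong) auto
        also have "\<dots> = (\<Sum>js\<in>?L. eval_word A v js)"
          using S fin_js[OF S] by (intro sum.group) auto
        finally show "(\<Sum>T\<in>Pow S. \<Sum>js\<in>{js. set js = T \<and> map ((!) w) js = t}. eval_word A v js) =
            eval_word A (\<lambda>i. \<Sum>j\<in>{j \<in> S. w ! j = i}. v j) t"
          by (simp add: eval_word_fibre_sum[OF S v])
      qed
      also have "\<dots> = eval_poly A (\<lambda>i. \<Sum>j\<in>{j \<in> S. w ! j = i}. v j) f"
        by (simp add: eval_poly_def)
      also have "\<dots> = 0"
      proof -
        have "\<forall>i. (\<Sum>j\<in>{j \<in> S. w ! j = i}. v j) \<in> alg_carrier A" using v by (intro allI sum_closed)
        then show ?thesis using f(1) by (simp add: identities_def)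
      qed
      finally show ?thesis .
    qed
    \<comment> \<open>Inclusion-exclusion in inductive form: the sum over all subsets of
      \<open>T\<close> vanishes, and so do the summands of the proper subsets.\<close>
    have H0: "H T = 0" if "finite T" for T
      using that
    proof (induction T rule: finite_psubset_induct)
      case (psubset T)
      have "(\<Sum>T'\<in>Pow T. H T') = H T + (\<Sum>T'\<in>Pow T - {T}. H T')"
        using psubset.hyps by (intro sum.remove) auto
      also have "(\<Sum>T'\<in>Pow T - {T}. H T') = 0"
        using psubset by (intro sum.neutral) auto
      finally show ?case using sum_H[OF psubset.hyps] by simp
    qed
    let ?P = "permutations_of_set {..<d}"
    let ?Q = "{js \<in> ?P. map ((!) w) js \<in> ?K}"
    have "multi_eval A d \<gamma> v = (\<Sum>js\<in>?Q. alg_scale A (\<gamma> js) (eval_word A v js))"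
      unfolding multi_eval_def
      by (intro sum.mono_neutral_right) (auto simp: \<gamma>_def in_keys_iff scale_zero_left cl)
    also have "\<dots> = (\<Sum>t\<in>?K. \<Sum>js\<in>{js \<in> ?Q. map ((!) w) js = t}. alg_scale A (\<gamma> js) (eval_word A v js))"
      using fin by (intro sum.group[symmetric]) auto
    also have "\<dots> = (\<Sum>t\<in>?K. \<Sum>js\<in>{js. set js = {..<d} \<and> map ((!) w) js = t}.
        alg_scale A (Poly_Mapping.lookup f t) (eval_word A v js))"
    proof (rule sum.cong[OF refl])
      fix t assume t: "t \<in> ?K"
      \<comment> \<open>No word of \<open>f\<close> is longer than \<open>d\<close>, so a term using
        all \<open>d\<close> new variables uses each of them once.\<close>
      have "distinct js" if "set js = {..<d}" "map ((!) w) js = t" for js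
      proof -
        have "length js \<le> d" using w(2)[OF t] that(2) by (auto simp: d_def)
        moreover have "d \<le> length js" using card_length[of js] that(1) by simp
        ultimately show ?thesis using that(1) by (intro card_distinct) simp
      qed
      then have eq: "{js \<in> ?Q. map ((!) w) js = t} = {js. set js = {..<d} \<and> map ((!) w) js = t}"
        using t by (auto simp: permutations_of_set_def)
      show "(\<Sum>js\<in>{js \<in> ?Q. map ((!) w) js = t}. alg_scale A (\<gamma> js) (eval_word A v js)) =
        (\<Sum>js\<in>{js. set js = {..<d} \<and> map ((!) w) js = t}.
          alg_scale A (Poly_Mapping.lookup f t) (eval_word A v js))"
        unfolding eq by (intro sum.cong) (auto simp: \<gamma>_def)
    qed
    also have "\<dots> = H {..<d}" by (simp add: H_def scale_sum cl)
    finally show "multi_eval A d \<gamma> v = 0" using H0[of "{..<d}"] by simp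
  qed
  moreover have "\<gamma> [0..<d] \<noteq> 0" using w(1) by (simp add: \<gamma>_def d_def map_nth in_keys_iff)
  ultimately show ?thesis using \<open>w \<noteq> []\<close> by (intro exI[of _ d] exI[of _ \<gamma>]) (auto simp: d_def)
qed

end

subsection \<open>Walks and identities of matrix algebras\<close>

text \<open>The letter \<open>x\<close> stands for an edge from the vertex \<open>p x\<close> to the vertex \<open>q x\<close>.\<close>

fun walk :: "(nat \<Rightarrow> nat) \<Rightarrow> (nat \<Rightarrow> nat) \<Rightarrow> nat \<Rightarrow> nat list \<Rightarrow> nat \<Rightarrow> bool" where
  "walk p q a [] b \<longleftrightarrow> a = b"
| "walk p q a (x # w) b \<longleftrightarrow> p x = a \<and> walk p q (q x) w b"

text \<open>These are the terms that survive in entry \<open>(a, b)\<close> when each letter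
  \<open>x\<close> is replaced by a matrix unit in place \<open>(p x, q x)\<close>.\<close>

definition walk_part ::
    "(nat \<Rightarrow> nat) \<Rightarrow> (nat \<Rightarrow> nat) \<Rightarrow> nat \<Rightarrow> nat \<Rightarrow> (nat list \<Rightarrow> 'k::zero) \<Rightarrow> nat list \<Rightarrow> 'k" where
  "walk_part p q a b c w = (if walk p q a w b then c w else 0)"

definition walk_data :: "nat \<Rightarrow> (nat \<Rightarrow> nat) \<Rightarrow> (nat \<Rightarrow> nat) \<Rightarrow> nat \<Rightarrow> nat \<Rightarrow> bool" where
  "walk_data n p q a b \<longleftrightarrow> (\<forall>x. p x < n) \<and> (\<forall>x. q x < n) \<and> a < n \<and> b < n"

definition walk_identity ::
    "('k::field, 'a::ab_group_add) alg \<Rightarrow> nat \<Rightarrow> nat \<Rightarrow> (nat list \<Rightarrow> 'k) \<Rightarrow> bool" where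
  "walk_identity A n m c \<longleftrightarrow>
     (\<forall>p q a b. walk_data n p q a b \<longrightarrow> multi_identity A m (walk_part p q a b c))"

lemma walk_cong:
  "(\<And>x. x \<in> set w \<Longrightarrow> p x = p' x \<and> q x = q' x) \<Longrightarrow> walk p q a w b \<longleftrightarrow> walk p' q' a w b"
  by (induction w arbitrary: a) auto

lemma walk_endpoints:
  "walk p q a w b \<Longrightarrow> w \<noteq> [] \<Longrightarrow> p (hd w) = a \<and> q (last w) = b"
  by (induction w arbitrary: a) (auto split: if_splits)

lemma walk_pair:
  assumes "\<And>x. p' x < n" "\<And>x. q' x < n" "a' < n" "b' < n"
  shows "walk (\<lambda>x. p x * n + p' x) (\<lambda>x. q x * n + q' x) (a * n + a') w (b * n + b')
    \<longleftrightarrow> walk p q a w b \<and> walk p' q' a' w b'"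
  using assms(3)
proof (induction w arbitrary: a a')
  case Nil
  then show ?case using assms by (simp add: mult_add_eq_iff)
next
  case (Cons x w)
  then show ?case using assms Cons.IH[of "q' x" "q x"] by (auto simp: mult_add_eq_iff)
qed

text \<open>The combinatorial form of the isomorphism between \<open>l\<close> by \<open>l\<close>
  matrices over \<open>n\<close> by \<open>n\<close> matrices and matrices of size
  \<open>l * n\<close>: \<open>div\<close> and \<open>mod\<close> by \<open>n\<close> split a walk
  into two walks along the same word.\<close>

lemma walk_identity_mult_iff:
  "walk_identity A (l * n) m c \<longleftrightarrow>
     (\<forall>p q a b. walk_data l p q a b \<longrightarrow> walk_identity A n m (walk_part p q a b c))"
proof
  assume *: "walk_identity A (l * n) m c"
  show "\<forall>p q a b. walk_data l p q a b \<longrightarrow> walk_identity A n m (walk_part p q a b c)"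
    unfolding walk_identity_def[of A n]
  proof (intro allI impI)
    fix p q a b p' q' a' b' assume d: "walk_data l p q a b" "walk_data n p' q' a' b'"
    have "walk_part p' q' a' b' (walk_part p q a b c) =
        walk_part (\<lambda>x. p x * n + p' x) (\<lambda>x. q x * n + q' x) (a * n + a') (b * n + b') c"
      using d(2) by (auto simp: walk_part_def walk_pair walk_data_def fun_eq_iff)
    moreover have "walk_data (l * n) (\<lambda>x. p x * n + p' x) (\<lambda>x. q x * n + q' x) (a * n + a') (b * n + b')"
      using d by (auto simp: walk_data_def mult_add_less)
    ultimately show "multi_identity A m (walk_part p' q' a' b' (walk_part p q a b c))"
      using * by (simp add: walk_identity_def)
  qed
next
  assume *: "\<forall>p q a b. walk_data l p q a b \<longrightarrow> walk_identity A n m (walk_part p q a b c)"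
  show "walk_identity A (l * n) m c"
    unfolding walk_identity_def
  proof (intro allI impI)
    fix p q a b assume d: "walk_data (l * n) p q a b"
    then have "0 < n" by (cases n) (auto simp: walk_data_def)
    define p1 q1 p2 q2 where "p1 = (\<lambda>x. p x div n)" "q1 = (\<lambda>x. q x div n)"
      "p2 = (\<lambda>x. p x mod n)" "q2 = (\<lambda>x. q x mod n)"
    note defs = this
    have d2: "walk_data n p2 q2 (a mod n) (b mod n)"
      using \<open>0 < n\<close> by (simp add: walk_data_def defs)
    have "walk_data l p1 q1 (a div n) (b div n)"
      using d by (auto simp: walk_data_def defs less_mult_imp_div_less)
    then have "multi_identity A m
        (walk_part p2 q2 (a mod n) (b mod n) (walk_part p1 q1 (a div n) (b div n) c))"
      using * d2 by (auto simp: walk_identity_def)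
    also have "walk_part p2 q2 (a mod n) (b mod n) (walk_part p1 q1 (a div n) (b div n) c) =
        walk_part p q a b c"
    proof
      fix w
      have "walk p q a w b \<longleftrightarrow> walk (\<lambda>x. p1 x * n + p2 x) (\<lambda>x. q1 x * n + q2 x)
          (a div n * n + a mod n) w (b div n * n + b mod n)"
        by (simp add: defs)
      also have "\<dots> \<longleftrightarrow> walk p1 q1 (a div n) w (b div n) \<and> walk p2 q2 (a mod n) w (b mod n)"
        using d2 by (intro walk_pair) (auto simp: walk_data_def)
      finally show "walk_part p2 q2 (a mod n) (b mod n) (walk_part p1 q1 (a div n) (b div n) c) w =
          walk_part p q a b c w"
        by (simp add: walk_part_def)
    qed
    finally show "multi_identity A m (walk_part p q a b c)" .
  qed
qed

text \<open>The factors \<open>r\<close> are exchanged for \<open>s\<close> one at a time, from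
  \<open>r ^ k * r\<close> to \<open>r ^ k * s\<close> and then, with the order of the factors
  swapped, to \<open>s * s ^ k\<close>. The assumption is applied to walk parts of \<open>c\<close>,
  hence its quantifier.\<close>

lemma walk_identity_power:
  assumes "\<And>c. walk_identity A r m c \<Longrightarrow> walk_identity A s m c"
  shows "walk_identity A (r ^ k) m c \<Longrightarrow> walk_identity A (s ^ k) m c"
proof (induction k arbitrary: c)
  case (Suc k)
  have "walk_identity A (r ^ k * r) m c" using Suc.prems by (simp add: mult.commute)
  then have "walk_identity A (r ^ k * s) m c"
    unfolding walk_identity_mult_iff using assms by blast
  then have "walk_identity A (s * r ^ k) m c" by (simp add: mult.commute)
  then have "walk_identity A (s * s ^ k) m c"
    unfolding walk_identity_mult_iff using Suc.IH by blast
  then show ?case by simp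
qed simp

section \<open>Matrix units\<close>

text \<open>The algebra need not have a unit, so an elementary matrix carries an entry
  \<open>x\<close>.\<close>

definition matrix_unit :: "nat \<Rightarrow> nat \<Rightarrow> 'a::zero \<Rightarrow> nat \<Rightarrow> nat \<Rightarrow> 'a" where
  "matrix_unit i j x k l = (if k = i \<and> l = j then x else 0)"

lemma sum_fun_apply: "sum f S a = (\<Sum>s\<in>S. f s a)"
  by (induction S rule: infinite_finite_induct) auto

context assoc_algebra
begin

lemma matrix_unit_closed:
  "i < n \<Longrightarrow> j < n \<Longrightarrow> x \<in> alg_carrier A \<Longrightarrow> matrix_unit i j x \<in> alg_carrier (mat_alg n A)"
  by (auto simp: mat_alg_def matrix_unit_def zero_closed)

text \<open>A product of matrix units survives only if the column of each factor is the row of the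
  next one, and it then sits in a single entry.\<close>

lemma eval_word_matrix_units:
  assumes "w \<noteq> []" "\<And>x. v x \<in> alg_carrier A" "\<And>x. q x < n"
  shows "eval_word (mat_alg n A) (\<lambda>x. matrix_unit (p x) (q x) (v x)) w a b =
    (if walk p q a w b then eval_word A v w else 0)"
  using assms(1)
proof (induction w arbitrary: a)
  case (Cons x w)
  show ?case
  proof (cases "w = []")
    case True
    then show ?thesis by (auto simp: matrix_unit_def)
  next
    case False
    have cl: "eval_word A v w \<in> alg_carrier A" using assms(2) by (rule eval_word_closed)
    have "eval_word (mat_alg n A) (\<lambda>x. matrix_unit (p x) (q x) (v x)) (x # w) a b =
        (\<Sum>k<n. alg_mult A (matrix_unit (p x) (q x) (v x) a k)
          (if walk p q k w b then eval_word A v w else 0))"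
      using False Cons.IH by (simp add: eval_word_Cons mat_alg_def)
    also have "\<dots> = (\<Sum>k<n. if k = q x then
        (if walk p q a (x # w) b then alg_mult A (v x) (eval_word A v w) else 0) else 0)"
      using assms(2) cl
      by (intro sum.cong) (auto simp: matrix_unit_def mult_zero_left mult_zero_right zero_closed)
    also have "\<dots> = (if walk p q a (x # w) b then alg_mult A (v x) (eval_word A v w) else 0)"
      using assms(3)[of x] by (subst sum.delta) auto
    finally show ?thesis using False by (simp add: eval_word_Cons)
  qed
qed simp

lemma multi_eval_matrix_units:
  assumes "0 < m" "\<And>x. v x \<in> alg_carrier A" "\<And>x. q x < n"
  shows "multi_eval (mat_alg n A) m c (\<lambda>x. matrix_unit (p x) (q x) (v x)) a b =
    multi_eval A m (walk_part p q a b c) v"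
proof -
  have "multi_eval (mat_alg n A) m c (\<lambda>x. matrix_unit (p x) (q x) (v x)) a b =
      (\<Sum>w\<in>permutations_of_set {..<m}. alg_scale A (c w)
        (eval_word (mat_alg n A) (\<lambda>x. matrix_unit (p x) (q x) (v x)) w a b))"
    by (simp add: multi_eval_def sum_fun_apply mat_alg_def)
  also have "\<dots> = multi_eval A m (walk_part p q a b c) v"
    unfolding multi_eval_def using assms
    by (intro sum.cong refl, subst eval_word_matrix_units)
      (auto simp: walk_part_def scale_zero_right scale_zero_left eval_word_closed dest: perm_lessThanD(4))
  finally show ?thesis .
qed

text \<open>By multilinearity it suffices to evaluate at matrix units, where the entries are the
  walk parts.\<close>

lemma multi_identity_mat_alg_iff:
  assumes "0 < m" "0 < n"
  shows "multi_identity (mat_alg n A) m c \<longleftrightarrow> walk_identity A n m c"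
proof
  assume *: "multi_identity (mat_alg n A) m c"
  show "walk_identity A n m c"
    unfolding walk_identity_def multi_identity_def
  proof (intro allI impI)
    fix p q a b and v :: "nat \<Rightarrow> 'a" assume d: "walk_data n p q a b" and v: "\<forall>i. v i \<in> alg_carrier A"
    have "multi_eval A m (walk_part p q a b c) v =
        multi_eval (mat_alg n A) m c (\<lambda>x. matrix_unit (p x) (q x) (v x)) a b"
      using d v assms by (intro multi_eval_matrix_units[symmetric]) (auto simp: walk_data_def)
    also have "multi_eval (mat_alg n A) m c (\<lambda>x. matrix_unit (p x) (q x) (v x)) = 0"
      using * d v by (auto simp: multi_identity_def walk_data_def matrix_unit_closed)
    finally show "multi_eval A m (walk_part p q a b c) v = 0" by simp
  qed
next
  assume *: "walk_identity A n m c"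
  interpret M: assoc_algebra "mat_alg n A" by (rule assoc_algebra_mat_alg)
  let ?unit = "\<lambda>X. \<exists>i j x. i < n \<and> j < n \<and> x \<in> alg_carrier A \<and> X = matrix_unit i j x"
  \<comment> \<open>Variables below \<open>t\<close> take arbitrary values, those from
    \<open>t\<close> to \<open>m - 1\<close> matrix units. The induction step expands the value of
    variable \<open>t\<close> into matrix units.\<close>
  have zero: "multi_eval (mat_alg n A) m c V = 0"
    if "t \<le> m" "\<forall>i. V i \<in> alg_carrier (mat_alg n A)" "\<forall>i. t \<le> i \<and> i < m \<longrightarrow> ?unit (V i)" for t V
    using that
  proof (induction t arbitrary: V)
    case 0
    \<comment> \<open>Variables from \<open>m\<close> on do not occur in the polynomial; they get
      default indices, which exist by \<open>0 < n\<close>.\<close>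
    have "\<forall>x. \<exists>i j y. i < n \<and> j < n \<and> y \<in> alg_carrier A \<and> (x < m \<longrightarrow> V x = matrix_unit i j y)"
      using "0.prems"(3) assms(2) zero_closed by (metis zero_le)
    then obtain p q v where pqv: "\<And>x. p x < n" "\<And>x. q x < n" "\<And>x. v x \<in> alg_carrier A"
      "\<And>x. x < m \<Longrightarrow> V x = matrix_unit (p x) (q x) (v x)"
      by metis
    show ?case
    proof (intro ext)
      fix a b
      have "multi_eval (mat_alg n A) m c V a b =
          multi_eval (mat_alg n A) m c (\<lambda>x. matrix_unit (p x) (q x) (v x)) a b"
        using pqv(4) by (intro fun_cong[OF fun_cong[OF multi_eval_cong]])
      also have "\<dots> = multi_eval A m (walk_part p q a b c) v"
        using assms pqv by (intro multi_eval_matrix_units)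
      also have "\<dots> = 0"
      proof (cases "a < n \<and> b < n")
        case True
        then show ?thesis using * pqv
          by (auto simp: walk_identity_def walk_data_def multi_identity_def)
      next
        case False
        \<comment> \<open>A walk starts at \<open>p (hd w)\<close> and ends at
          \<open>q (last w)\<close>, both below \<open>n\<close>.\<close>
        have "walk_part p q a b c w = 0" if "w \<in> permutations_of_set {..<m}" for w
        proof -
          have "\<not> walk p q a w b"
            using False perm_lessThanD(4)[OF that assms(1)] pqv(1)[of "hd w"] pqv(2)[of "last w"]
              walk_endpoints[of p q a w b] by auto
          then show ?thesis by (simp add: walk_part_def)
        qed
        then show ?thesis using pqv(3) by (simp add: multi_eval_def scale_zero_left eval_word_closed)
      qed
      finally show "multi_eval (mat_alg n A) m c V a b = 0 a b" by simp
    qed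
  next
    case (Suc t)
    let ?u = "\<lambda>(i, j). matrix_unit i j (V t i j)"
    have entry: "V t i j \<in> alg_carrier A" for i j using Suc.prems(2) mat_alg_entry by blast
    have "V t = (\<Sum>s\<in>{..<n} \<times> {..<n}. ?u s)"
    proof (intro ext)
      fix a b
      have "(\<Sum>s\<in>{..<n} \<times> {..<n}. ?u s) a b =
          (\<Sum>s\<in>{..<n} \<times> {..<n}. if s = (a, b) then V t a b else 0)"
        unfolding sum_fun_apply by (intro sum.cong) (auto simp: matrix_unit_def split: if_splits)
      also have "\<dots> = V t a b"
      proof -
        have "V t \<in> alg_carrier (mat_alg n A)" using Suc.prems(2) by simp
        then have "\<not> (a < n \<and> b < n) \<Longrightarrow> V t a b = 0" by (auto simp: mat_alg_def)
        then show ?thesis by (subst sum.delta) auto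
      qed
      finally show "V t a b = (\<Sum>s\<in>{..<n} \<times> {..<n}. ?u s) a b" by simp
    qed
    then have "multi_eval (mat_alg n A) m c V =
        multi_eval (mat_alg n A) m c (V(t := \<Sum>s\<in>{..<n} \<times> {..<n}. ?u s))"
      using fun_upd_triv[of V t] by simp
    also have "\<dots> = (\<Sum>s\<in>{..<n} \<times> {..<n}. multi_eval (mat_alg n A) m c (V(t := ?u s)))"
      using Suc.prems entry
      by (intro M.multi_eval_update_sum) (auto intro!: matrix_unit_closed)
    also have "\<dots> = 0"
    proof (intro sum.neutral ballI)
      fix s assume "s \<in> {..<n} \<times> {..<n}"
      then obtain i j where s: "s = (i, j)" "i < n" "j < n" by auto
      show "multi_eval (mat_alg n A) m c (V(t := ?u s)) = 0"
      proof (rule Suc.IH)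
        show "t \<le> m" using Suc.prems by simp
        show "\<forall>k. (V(t := ?u s)) k \<in> alg_carrier (mat_alg n A)"
          using Suc.prems(2) s entry by (auto intro: matrix_unit_closed)
        show "\<forall>k. t \<le> k \<and> k < m \<longrightarrow> ?unit ((V(t := ?u s)) k)"
        proof (intro allI impI)
          fix k assume k: "t \<le> k \<and> k < m"
          show "?unit ((V(t := ?u s)) k)"
          proof (cases "k = t")
            case True
            then have "(V(t := ?u s)) k = matrix_unit i j (V t i j)" using s(1) by simp
            then show ?thesis using s(2,3) entry by blast
          next
            case False
            then show ?thesis using Suc.prems(3) k by auto
          qed
        qed
      qed
    qed
    finally show ?case .
  qed
  show "multi_identity (mat_alg n A) m c" 
    unfolding multi_identity_def by (intro allI impI zero[of m]) auto
qed

end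

subsection \<open>Nilpotent algebras\<close>

text \<open>All multilinear monomials of degree at least \<open>m0\<close> are identities, so the
  sequence of roots is eventually \<open>0\<close> and visibly converges.\<close>

lemma PI_exp_nilpotent:
  fixes A :: "('k::field, 'a::ab_group_add) alg"
  assumes "assoc_algebra A" "0 < m0"
    and nil: "\<And>v. (\<And>i. v i \<in> alg_carrier A) \<Longrightarrow> eval_word A v [0..<m0] = 0"
  shows "PI_exp A = 0"
proof -
  interpret assoc_algebra A by fact
  have nil': "eval_word A v w = 0" if "\<And>i. v i \<in> alg_carrier A" "m0 \<le> length w" for v w
  proof -
    \<comment> \<open>The assumption concerns one fixed word, so the valuation is moved along the
      positions of \<open>w\<close>.\<close>
    let ?v = "\<lambda>i. if i < length w then v (w ! i) else 0"
    have cl: "?v i \<in> alg_carrier A" for i using that(1) zero_closed by simp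
    have "eval_word A v w = eval_word A v (map ((!) w) [0..<length w])" by (simp add: map_nth)
    also have "\<dots> = eval_word A ?v [0..<length w]"
      unfolding eval_word_map by (intro eval_word_cong) auto
    also have "[0..<length w] = [0..<m0] @ [m0..<length w]"
      using that(2) upt_add_eq_append[of 0 m0 "length w - m0"] by simp
    also have "eval_word A ?v \<dots> = 0"
    proof (cases "length w = m0")
      case True
      then show ?thesis using nil[OF cl] by simp
    next
      case False
      then have ne: "[0..<m0] \<noteq> []" "[m0..<length w] \<noteq> []" using assms(2) that(2) by auto
      show ?thesis
        unfolding eval_word_append[OF ne cl] nil[OF cl] by (intro mult_zero_left eval_word_closed cl)
    qed
    finally show ?thesis .
  qed
  have "codim m A = 0" if m: "m0 \<le> m" for m
  proof -
    let ?F = "{Poly_Mapping.single (map \<sigma> [0..<m]) (1::'k) | \<sigma>. \<sigma> permutes {..<m}}"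
    have "?F \<subseteq> identities A"
    proof clarify
      fix \<sigma> :: "nat \<Rightarrow> nat"
      have "eval_poly A v (Poly_Mapping.single (map \<sigma> [0..<m]) (1::'k)) = 0"
        if "\<And>i. v i \<in> alg_carrier A" for v
        using nil'[OF that, of "map \<sigma> [0..<m]"] m by (simp add: eval_poly_def scale_zero_right)
      moreover have "map \<sigma> [0..<m] \<noteq> []" using assms(2) m by simp
      ultimately show "Poly_Mapping.single (map \<sigma> [0..<m]) (1::'k) \<in> identities A"
        by (auto simp: identities_def free_alg_def lookup_single when_def)
    qed
    then have sub: "multilinear m \<subseteq> identities A"
      unfolding multilinear_def by (intro ncpoly.span_minimal subspace_identities)
    have fin: "finite ?F" by (simp add: finite_permutations setcompr_eq_image)
    have span: "ncpoly.subspace (multilinear m :: 'k ncpoly set)" "multilinear m \<subseteq> ncpoly.span ?F"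
      by (simp_all add: multilinear_def)
    have "quotient_dim (multilinear m) (multilinear m :: 'k ncpoly set) = 0"
      using quotient_dim_eq[OF span(1) span(1) order_refl fin span(2)] by simp
    then show ?thesis using sub by (simp add: codim_def Int_absorb2)
  qed
  then have "\<forall>\<^sub>F m in sequentially. root m (real (codim m A)) = 0"
    unfolding eventually_sequentially by (intro exI[of _ m0] allI impI) simp
  then have "(\<lambda>m. root m (real (codim m A))) \<longlonglongrightarrow> 0" by (rule tendsto_eventually)
  then show ?thesis unfolding PI_exp_def by (rule limI)
qed

subsection \<open>Latyshev's lemma\<close>

text \<open>The coefficients \<open>\<rho>\<close> are chosen before the valuation: the difference
  of \<open>w\<close> and the combination is to vanish under all valuations at once.\<close>

definition spanned_mod_identities ::
    "('k::field, 'a::ab_group_add) alg \<Rightarrow> nat list set \<Rightarrow> nat list \<Rightarrow> bool" where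
  "spanned_mod_identities A G w \<longleftrightarrow> (\<exists>\<rho>. \<forall>v. (\<forall>i. v i \<in> alg_carrier A) \<longrightarrow>
     eval_word A v w = (\<Sum>u\<in>G. alg_scale A (\<rho> u) (eval_word A v u)))"

text \<open>Where \<open>\<tau>\<close> first departs from the identity it has a larger index
  \<open>x\<close> in place of \<open>y\<close>. The heads of the blocks decrease, so a smaller
  letter appears there.\<close>

lemma concat_map_perm_lex:
  assumes bs: "[] \<notin> set bs" "sorted_wrt (>) (map hd bs)" "length bs = d"
    and \<tau>: "\<tau> \<in> permutations_of_set {..<d}" "\<tau> \<noteq> [0..<d]"
    and w: "w = w0 @ concat bs" "w \<in> permutations_of_set {..<m}"
  shows "w0 @ concat (map ((!) bs) \<tau>) \<in> permutations_of_set {..<m}"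
    and "(w0 @ concat (map ((!) bs) \<tau>), w) \<in> lex less_than"
proof -
  note p = perm_lessThanD[OF \<tau>(1)]
  have bs': "concat bs = concat (map ((!) bs) [0..<d])" using bs(3) map_nth[of bs] by simp
  have "mset \<tau> = mset [0..<d]"
    using p(1) iffD1[OF set_eq_iff_mset_eq_distinct[OF p(2) distinct_upt]]
    by (metis atLeast0LessThan set_upt)
  then have "mset (concat (map ((!) bs) \<tau>)) = mset (concat bs)"
    unfolding bs' by (metis mset_concat mset_map sum_mset_sum_list)
  then have "mset (w0 @ concat (map ((!) bs) \<tau>)) = mset w" by (simp add: w(1))
  then show *: "w0 @ concat (map ((!) bs) \<tau>) \<in> permutations_of_set {..<m}"
    using w(2) mset_eq_setD mset_eq_imp_distinct_iff unfolding permutations_of_set_def by blast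
  obtain zs x y xs ys where eq: "\<tau> = zs @ x # xs" "[0..<d] = zs @ y # ys" "x \<noteq> y"
    using same_length_different[OF \<tau>(2)] p(3) by auto
  have "x \<in> set [0..<d]" "x \<notin> set zs" using p eq(1) by auto
  then have x: "x \<in> set ys" using eq(2,3) by auto
  have "sorted_wrt (<) (zs @ y # ys)" unfolding eq(2)[symmetric] by simp
  then have "y < x" using x by (simp add: sorted_wrt_append)
  have lt: "x < d" "y < d"
  proof -
    have "set [0..<d] = set (zs @ y # ys)" using eq(2) by simp
    then show "x < d" "y < d" using x by auto
  qed
  then have ne: "bs ! x \<noteq> []" "bs ! y \<noteq> []" using bs(1,3) by (metis nth_mem)+
  have "hd (bs ! x) < hd (bs ! y)"
    using sorted_wrt_nth_less[OF bs(2) \<open>y < x\<close>] lt bs(3) by simp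
  then show "(w0 @ concat (map ((!) bs) \<tau>), w) \<in> lex less_than"
    using perm_lessThanD(3)[OF *] perm_lessThanD(3)[OF w(2)] ne
    unfolding lex_conv
    by (intro CollectI case_prodI conjI exI[of _ "w0 @ concat (map ((!) bs) zs)"]
        exI[of _ "hd (bs ! x)"] exI[of _ "hd (bs ! y)"]
        exI[of _ "tl (bs ! x) @ concat (map ((!) bs) xs)"]
        exI[of _ "tl (bs ! y) @ concat (map ((!) bs) ys)"])
      (simp_all add: eq w(1) bs')
qed

context assoc_algebra
begin

text \<open>Substitute the blocks into the identity and multiply by \<open>w0\<close> from the left.
  Without a unit the empty \<open>w0\<close> is no factor and needs its own case.\<close>

lemma multi_identity_blocks:
  assumes \<gamma>: "multi_identity A d \<gamma>" and v: "\<And>i. v i \<in> alg_carrier A"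
    and bs: "[] \<notin> set bs" "length bs = d" "0 < d"
  shows "(\<Sum>\<tau>\<in>permutations_of_set {..<d}.
    alg_scale A (\<gamma> \<tau>) (eval_word A v (w0 @ concat (map ((!) bs) \<tau>)))) = 0"
proof -
  let ?P = "permutations_of_set {..<d}"
  have cl: "eval_word A v w \<in> alg_carrier A" for w using v by (rule eval_word_closed)
  define v' where "v' = (\<lambda>j. eval_word A v (bs ! j))"
  have ne: "bs ! j \<noteq> []" if "j < d" for j using that bs by (metis nth_mem)
  have eval: "eval_word A v (concat (map ((!) bs) \<tau>)) = eval_word A v' \<tau>" if "\<tau> \<in> ?P" for \<tau>
    unfolding v'_def using perm_lessThanD(1)[OF that] ne v by (intro eval_word_concat_map) auto
  have "(\<Sum>\<tau>\<in>?P. alg_scale A (\<gamma> \<tau>) (eval_word A v (concat (map ((!) bs) \<tau>)))) = multi_eval A d \<gamma> v'"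
    unfolding multi_eval_def by (intro sum.cong) (auto simp: eval)
  also have "\<dots> = 0" using \<gamma> cl by (simp add: multi_identity_def v'_def)
  finally have zero: "(\<Sum>\<tau>\<in>?P. alg_scale A (\<gamma> \<tau>) (eval_word A v (concat (map ((!) bs) \<tau>)))) = 0" .
  show ?thesis
  proof (cases "w0 = []")
    case True
    then show ?thesis using zero by simp
  next
    case False
    have "(\<Sum>\<tau>\<in>?P. alg_scale A (\<gamma> \<tau>) (eval_word A v (w0 @ concat (map ((!) bs) \<tau>)))) =
        (\<Sum>\<tau>\<in>?P. alg_mult A (eval_word A v w0)
          (alg_scale A (\<gamma> \<tau>) (eval_word A v (concat (map ((!) bs) \<tau>)))))"
    proof (intro sum.cong refl)
      fix \<tau> assume \<tau>: "\<tau> \<in> ?P"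
      then have "concat (map ((!) bs) \<tau>) \<noteq> []"
        using perm_lessThanD[OF \<tau>] ne bs(3) by (cases \<tau>) auto
      then show "alg_scale A (\<gamma> \<tau>) (eval_word A v (w0 @ concat (map ((!) bs) \<tau>))) =
          alg_mult A (eval_word A v w0) (alg_scale A (\<gamma> \<tau>) (eval_word A v (concat (map ((!) bs) \<tau>))))"
        using False v by (simp add: eval_word_append mult_scale_right cl)
    qed
    also have "\<dots> = alg_mult A (eval_word A v w0)
        (\<Sum>\<tau>\<in>?P. alg_scale A (\<gamma> \<tau>) (eval_word A v (concat (map ((!) bs) \<tau>))))"
      by (intro mult_sum_right[symmetric] scale_closed cl)
    finally show ?thesis unfolding zero by (simp add: mult_zero_right cl)
  qed
qed

text \<open>Latyshev's lemma: a word with a decreasing subsequence of length \<open>d\<close> is cut into blocks at the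
  letters of the subsequence; the identity of degree \<open>d\<close> rewrites it into smaller words.\<close>

lemma spanned_by_colourable:
  assumes \<gamma>: "multi_identity A (Suc D) \<gamma>" "\<gamma> [0..<Suc D] \<noteq> 0"
    and G: "G = {w \<in> permutations_of_set {..<m}. colourable D w}"
  shows "w \<in> permutations_of_set {..<m} \<Longrightarrow> spanned_mod_identities A G w"
proof (induction w rule: wf_induct_rule[OF wf_lex[OF wf_less_than]])
  case (1 w)
  have cl: "eval_word A v w \<in> alg_carrier A" if "\<And>i. v i \<in> alg_carrier A" for v w
    using that by (rule eval_word_closed)
  have finG: "finite G" by (simp add: G)
  show ?case
  proof (cases "colourable D w")
    case True
    then have "w \<in> G" using "1.prems" G by simp
    have "eval_word A v w = (\<Sum>u\<in>G. alg_scale A (if u = w then 1 else 0) (eval_word A v u))"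
      if v: "\<And>i. v i \<in> alg_carrier A" for v
    proof -
      have "(\<Sum>u\<in>G. alg_scale A (if u = w then 1 else 0) (eval_word A v u)) =
          (\<Sum>u\<in>G. if u = w then eval_word A v w else 0)"
        by (intro sum.cong) (auto simp: scale_one scale_zero_left cl v)
      then show ?thesis using \<open>w \<in> G\<close> finG by simp
    qed
    then show ?thesis unfolding spanned_mod_identities_def
      by (intro exI[of _ "\<lambda>u. if u = w then 1 else 0"]) simp
  next
    case False
    let ?d = "Suc D"
    let ?P = "permutations_of_set {..<?d}"
    obtain u where u: "length u = ?d" "sorted_wrt (>) u" "subseq u w"
      using not_colourable_imp_decreasing[OF perm_lessThanD(2)[OF "1.prems"] False] by blast
    obtain w0 bs where w: "w = w0 @ concat bs" and bs: "[] \<notin> set bs" "map hd bs = u"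
      using subseq_block_decomposition[OF u(3)] by blast
    have len: "length bs = ?d" using u(1) bs(2) by (metis length_map)
    have srt: "sorted_wrt (>) (map hd bs)" using u(2) bs(2) by simp
    define W where "W = (\<lambda>\<tau>. w0 @ concat (map ((!) bs) \<tau>))"
    define e where "e = [0..<?d]"
    have We: "W e = w" using map_nth[of bs] len by (simp add: W_def w e_def del: upt_Suc)
    have e: "e \<in> ?P" by (simp add: e_def permutations_of_set_def atLeast0LessThan del: upt_Suc)
    have "spanned_mod_identities A G (W \<tau>)" if "\<tau> \<in> ?P - {e}" for \<tau>
      using concat_map_perm_lex[OF bs(1) srt len _ _ w "1.prems"] that "1.IH"
      by (simp add: W_def e_def del: upt_Suc)
    then obtain \<rho> where \<rho>: "\<And>\<tau> v. \<tau> \<in> ?P - {e} \<Longrightarrow> (\<And>i. v i \<in> alg_carrier A) \<Longrightarrow>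
        eval_word A v (W \<tau>) = (\<Sum>u\<in>G. alg_scale A (\<rho> \<tau> u) (eval_word A v u))"
      unfolding spanned_mod_identities_def by metis
    \<comment> \<open>The relation among the block permutations is solved for the term of
      \<open>e\<close>, whose word is \<open>w\<close>, and the smaller words are replaced by their
      combinations over \<open>G\<close>.\<close>
    define \<sigma> where "\<sigma> = (\<lambda>u. \<Sum>\<tau>\<in>?P - {e}. - (\<gamma> \<tau> / \<gamma> e) * \<rho> \<tau> u)"
    have "eval_word A v w = (\<Sum>u\<in>G. alg_scale A (\<sigma> u) (eval_word A v u))"
      if v: "\<And>i. v i \<in> alg_carrier A" for v
    proof -
      have cl: "eval_word A v w \<in> alg_carrier A" for w using v by (rule cl)
      let ?y = "\<Sum>\<tau>\<in>?P - {e}. alg_scale A (\<gamma> \<tau>) (eval_word A v (W \<tau>))"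
      have "0 = (\<Sum>\<tau>\<in>?P. alg_scale A (\<gamma> \<tau>) (eval_word A v (W \<tau>)))"
        unfolding W_def using multi_identity_blocks[OF \<gamma>(1) v bs(1) len] by simp
      also have "\<dots> = alg_scale A (\<gamma> e) (eval_word A v w) + ?y"
        using e We by (subst sum.remove[of _ e]) auto
      finally have 0: "alg_scale A (- inverse (\<gamma> e)) (alg_scale A (\<gamma> e) (eval_word A v w) + ?y) = 0"
        by (simp add: scale_zero_right)
      have "alg_scale A (- inverse (\<gamma> e)) (alg_scale A (\<gamma> e) (eval_word A v w)) =
          alg_scale A (- 1) (eval_word A v w)"
        using \<gamma>(2) cl by (simp add: scale_scale e_def)
      moreover have "alg_scale A (- 1) (eval_word A v w) + eval_word A v w = 0"
        using scale_left_distrib[OF cl[of w], of "-1" 1] by (simp add: scale_one scale_zero_left cl)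
      ultimately have "eval_word A v w = alg_scale A (- inverse (\<gamma> e)) ?y"
        using 0 by (simp add: scale_right_distrib scale_closed sum_closed cl)
          (metis add_left_cancel)
      also have "\<dots> = (\<Sum>\<tau>\<in>?P - {e}. alg_scale A (- (\<gamma> \<tau> / \<gamma> e)) (eval_word A v (W \<tau>)))"
        by (simp add: scale_sum scale_scale scale_closed cl divide_inverse mult.commute)
      also have "\<dots> = (\<Sum>\<tau>\<in>?P - {e}. \<Sum>u\<in>G. alg_scale A (- (\<gamma> \<tau> / \<gamma> e) * \<rho> \<tau> u) (eval_word A v u))"
        using \<rho>[OF _ v] by (intro sum.cong) (auto simp: scale_sum scale_scale scale_closed cl)
      also have "\<dots> = (\<Sum>u\<in>G. alg_scale A (\<sigma> u) (eval_word A v u))"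
        unfolding \<sigma>_def by (subst sum.swap) (simp add: scale_sum_left cl)
      finally show ?thesis .
    qed
    then show ?thesis unfolding spanned_mod_identities_def by blast
  qed
qed

section \<open>Counting linear equations\<close>

text \<open>Rewriting each walk part over \<open>G\<close>, it suffices that all coefficients
  vanish: one linear equation in the unknowns \<open>c w\<close> for each \<open>p\<close>,
  \<open>q\<close>, \<open>a\<close>, \<open>b\<close> and each \<open>u\<close> in
  \<open>G\<close>.\<close>

lemma walk_identity_exists:
  assumes span: "\<And>w. w \<in> permutations_of_set {..<m} \<Longrightarrow> spanned_mod_identities A G w"
    and fin: "finite G" and U: "U \<subseteq> permutations_of_set {..<m}"
    and card: "n ^ (2 * m + 2) * card G < card U"
  shows "\<exists>c. (\<exists>w. c w \<noteq> 0) \<and> (\<forall>w. c w \<noteq> 0 \<longrightarrow> w \<in> U) \<and> walk_identity A n m c"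
proof -
  \<comment> \<open>Only the letters below \<open>m\<close> matter, so finitely many
    \<open>p\<close> and \<open>q\<close> suffice: \<open>m\<close> choices for each and two
    endpoints give the exponent \<open>2 * m + 2\<close>.\<close>
  let ?P = "PiE {..<m} (\<lambda>_. {..<n})"
  let ?E = "?P \<times> ?P \<times> {..<n} \<times> {..<n} \<times> G"
  obtain \<rho> where \<rho>: "\<And>w v. w \<in> permutations_of_set {..<m} \<Longrightarrow> (\<And>i. v i \<in> alg_carrier A) \<Longrightarrow>
      eval_word A v w = (\<Sum>u\<in>G. alg_scale A (\<rho> w u) (eval_word A v u))"
    using span unfolding spanned_mod_identities_def by metis
  define M where "M = (\<lambda>(p, q, a, b, u) w. if walk p q a w b then \<rho> w u else 0)"
  have "finite ?P" by (intro finite_PiE) auto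
  then have "finite ?E" using fin by auto
  moreover have "card ?E = n ^ (2 * m + 2) * card G"
    by (simp add: card_cartesian_product card_PiE power_add mult_2 power2_eq_square)
  moreover have "finite U" using U by (rule finite_subset) simp
  ultimately have "\<exists>c. (\<exists>w\<in>U. c w \<noteq> 0) \<and> (\<forall>e\<in>?E. (\<Sum>w\<in>U. c w * M e w) = 0)"
    using card by (intro underdetermined_system) simp_all
  then obtain c where c: "\<exists>w\<in>U. c w \<noteq> 0" "\<And>e. e \<in> ?E \<Longrightarrow> (\<Sum>w\<in>U. c w * M e w) = 0"
    by blast
  define c' where "c' = (\<lambda>w. if w \<in> U then c w else 0)"
  have "walk_identity A n m c'"
    unfolding walk_identity_def multi_identity_def
  proof (intro allI impI)
    fix p q a b and v :: "nat \<Rightarrow> 'a"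
    assume d: "walk_data n p q a b" and v: "\<forall>i. v i \<in> alg_carrier A"
    let ?W = "permutations_of_set {..<m}"
    have cl: "eval_word A v w \<in> alg_carrier A" for w using v by (simp add: eval_word_closed)
    have zero: "(\<Sum>w\<in>?W. walk_part p q a b c' w * \<rho> w u) = 0" if "u \<in> G" for u
    proof -
      let ?p = "restrict p {..<m}" and ?q = "restrict q {..<m}"
      have "(\<Sum>w\<in>?W. walk_part p q a b c' w * \<rho> w u) = (\<Sum>w\<in>U. walk_part p q a b c' w * \<rho> w u)"
        using U by (intro sum.mono_neutral_right) (auto simp: walk_part_def c'_def)
      also have "\<dots> = (\<Sum>w\<in>U. c w * M (?p, ?q, a, b, u) w)"
      proof (intro sum.cong refl)
        fix w assume w: "w \<in> U"
        then have "set w = {..<m}" using U perm_lessThanD(1) by blast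
        then have "walk p q a w b \<longleftrightarrow> walk ?p ?q a w b" by (intro walk_cong) auto
        then show "walk_part p q a b c' w * \<rho> w u = c w * M (?p, ?q, a, b, u) w"
          using w by (simp add: walk_part_def M_def c'_def)
      qed
      also have "\<dots> = 0" using d that by (intro c(2)) (auto simp: walk_data_def)
      finally show ?thesis .
    qed
    have "multi_eval A m (walk_part p q a b c') v =
        (\<Sum>w\<in>?W. \<Sum>u\<in>G. alg_scale A (walk_part p q a b c' w * \<rho> w u) (eval_word A v u))"
      unfolding multi_eval_def using \<rho> v
      by (intro sum.cong) (auto simp: scale_sum scale_scale scale_closed cl)
    also have "\<dots> = (\<Sum>u\<in>G. alg_scale A (\<Sum>w\<in>?W. walk_part p q a b c' w * \<rho> w u) (eval_word A v u))"
      by (subst sum.swap) (simp add: scale_sum_left cl)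
    also have "\<dots> = 0" by (intro sum.neutral) (simp add: zero scale_zero_left cl)
    finally show "multi_eval A m (walk_part p q a b c') v = 0" .
  qed
  moreover have "\<exists>w. c' w \<noteq> 0" "\<forall>w. c' w \<noteq> 0 \<longrightarrow> w \<in> U" using c(1) by (auto simp: c'_def)
  ultimately show ?thesis by blast
qed

end

subsection \<open>Greedy walks\<close>

text \<open>Each letter is made to end where the next one starts, and the last to end at
  \<open>0\<close>. Distinct letters allow this.\<close>

lemma walk_through_vertices:
  "distinct w \<Longrightarrow> w \<noteq> [] \<Longrightarrow> \<exists>q. (\<forall>x. q x = 0 \<or> q x \<in> range p) \<and> walk p q (p (hd w)) w 0"
proof (induction w)
  case (Cons x w)
  show ?case
  proof (cases "w = []")
    case True
    then show ?thesis by (intro exI[of _ "\<lambda>_. 0"]) simp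
  next
    case False
    then obtain q where q: "\<forall>x. q x = 0 \<or> q x \<in> range p" "walk p q (p (hd w)) w 0"
      using Cons by auto
    have "walk p (q(x := p (hd w))) (p (hd w)) w 0 \<longleftrightarrow> walk p q (p (hd w)) w 0"
      using Cons.prems by (intro walk_cong) auto
    then have "walk p (q(x := p (hd w))) (p (hd (x # w))) (x # w) 0"
      using q(2) by (simp del: fun_upd_apply add: fun_upd_same)
    moreover have "\<forall>y. (q(x := p (hd w))) y = 0 \<or> (q(x := p (hd w))) y \<in> range p"
      using q(1) by simp
    ultimately show ?thesis by blast
  qed
qed simp

text \<open>The right-hand side depends on \<open>a\<close> and \<open>z\<close> alone, so two walks
  from \<open>a\<close> that share a prefix leave it from the same vertex.\<close>

lemma walk_appendD: "walk p q a (z @ x # u) b \<Longrightarrow> p x = foldl (\<lambda>_ y. q y) a z"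
  by (induction z arbitrary: a) auto

text \<open>If the letters are coloured increasingly along \<open>w\<close>, then \<open>w\<close> always continues with the least
  unused letter that leaves the current vertex.\<close>

lemma walk_coloured_lex_least:
  assumes w: "w \<in> permutations_of_set {..<m}" "sorted_wrt (\<lambda>x y. p x = p y \<longrightarrow> x < y) w"
    and u: "u \<in> permutations_of_set {..<m}" "u \<noteq> w"
    and walk: "walk p q a w b" "walk p q a u b"
  shows "(w, u) \<in> lex less_than"
proof -
  note pw = perm_lessThanD[OF w(1)] and pu = perm_lessThanD[OF u(1)]
  obtain z x y u' w' where eq: "u = z @ x # u'" "w = z @ y # w'" "x \<noteq> y"
    using same_length_different[OF u(2)] pw(3) pu(3) by auto
  have "p x = p y" using walk walk_appendD eq(1,2) by metis
  moreover have "x \<in> set w'"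
  proof -
    have "x \<in> set w" "x \<notin> set z" using pw pu eq(1) by auto
    then show ?thesis using eq by auto
  qed
  ultimately have "y < x" using w(2) eq(2) by (auto simp: sorted_wrt_append)
  then show ?thesis using eq pw(3) pu(3) unfolding lex_conv by auto
qed

context assoc_algebra
begin

text \<open>Take the lexicographically greatest word \<open>w\<close> in the support of
  \<open>c\<close> and the walk given by its colouring. Any other word following this walk is
  greater than \<open>w\<close>, so the walk part has the single term \<open>c w\<close>.\<close>

lemma not_walk_identity:
  assumes nz: "v \<in> UNIV \<rightarrow> alg_carrier A" "eval_word A v [0..<m] \<noteq> 0"
    and m: "0 < m" and N: "0 < N" and c: "\<exists>w. c w \<noteq> 0"
    and supp: "\<And>w. c w \<noteq> 0 \<Longrightarrow> w \<in> permutations_of_set {..<m} \<and> colourable N w"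
  shows "\<not> walk_identity A N m c"
proof
  assume id: "walk_identity A N m c"
  let ?W = "permutations_of_set {..<m}"
  let ?S = "{w. c w \<noteq> 0}"
  let ?r = "lex less_than \<inter> ?S \<times> ?S"
  have "finite ?S" using supp by (intro finite_subset[of ?S ?W]) auto
  then have "finite ?r" by auto
  moreover have "acyclic ?r" by (intro wf_acyclic wf_Int1 wf_lex wf_less_than)
  ultimately have wf: "wf (?r\<inverse>)" by (rule finite_acyclic_wf_converse)
  obtain w' where "w' \<in> ?S" using c by auto
  then obtain w where w: "w \<in> ?S" and max: "\<And>u. (u, w) \<in> ?r\<inverse> \<Longrightarrow> u \<notin> ?S"
    by (rule wfE_min[OF wf]) blast
  have wW: "w \<in> ?W" and "colourable N w" using supp w by auto
  note pw = perm_lessThanD[OF wW]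
  obtain k where k: "increasing_colouring N k w" using \<open>colourable N w\<close> by (auto simp: colourable_def)
  \<comment> \<open>The colouring is bounded only on the letters of \<open>w\<close>; elsewhere
    \<open>0\<close> is a safe vertex.\<close>
  define p where "p = (\<lambda>x. if x < m then k x else 0)"
  have pN: "p x < N" for x using k N pw(1) by (auto simp: p_def increasing_colouring_def)
  have srt: "sorted_wrt (\<lambda>x y. p x = p y \<longrightarrow> x < y) w"
    by (rule sorted_wrt_mono_rel[rotated, where P = "\<lambda>x y. k x = k y \<longrightarrow> x < y"])
      (use k pw(1) in \<open>auto simp: increasing_colouring_def p_def\<close>)
  obtain q where q: "\<forall>x. q x = 0 \<or> q x \<in> range p" "walk p q (p (hd w)) w 0"
    using walk_through_vertices[OF pw(2) pw(4)[OF m]] by blast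
  have qN: "q x < N" for x using q(1) pN N by (metis imageE)
  \<comment> \<open>Relabelling gives the letter at position \<open>i\<close> of \<open>w\<close>
    the value \<open>v i\<close>, so that \<open>w\<close> evaluates to the given nonzero
    product.\<close>
  define V where "V = (\<lambda>x. if x < m then v (inv_into {..<m} ((!) w) x) else 0)"
  have V: "\<And>i. V i \<in> alg_carrier A" using nz(1) zero_closed by (auto simp: V_def)
  have eval: "eval_word A V w = eval_word A v [0..<m]"
  proof -
    have "eval_word A V w = eval_word A V (map ((!) w) [0..<m])" using pw(3) map_nth[of w] by simp
    also have "\<dots> = eval_word A v [0..<m]"
      unfolding eval_word_map
    proof (rule eval_word_cong)
      fix i assume "i \<in> set [0..<m]"
      then have i: "i < m" by simp
      have "inj_on ((!) w) {..<m}" using pw by (intro inj_on_nth) auto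
      then have "inv_into {..<m} ((!) w) (w ! i) = i" using i by simp
      moreover have "w ! i < m" using pw i nth_mem[of i w] by auto
      ultimately show "V (w ! i) = v i" by (simp add: V_def)
    qed
    finally show ?thesis .
  qed
  have "0 = multi_eval A m (walk_part p q (p (hd w)) 0 c) V"
    using id pN qN N V by (auto simp: walk_identity_def walk_data_def multi_identity_def)
  also have "\<dots> = (\<Sum>u\<in>?W. if u = w then alg_scale A (c w) (eval_word A V w) else 0)"
    unfolding multi_eval_def
  proof (intro sum.cong refl)
    fix u assume u: "u \<in> ?W"
    show "alg_scale A (walk_part p q (p (hd w)) 0 c u) (eval_word A V u) =
        (if u = w then alg_scale A (c w) (eval_word A V w) else 0)"
    proof (cases "u = w")
      case True
      then show ?thesis using q(2) by (simp add: walk_part_def)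
    next
      case False
      have "walk_part p q (p (hd w)) 0 c u = 0"
      proof (rule ccontr)
        assume "walk_part p q (p (hd w)) 0 c u \<noteq> 0"
        then have "walk p q (p (hd w)) u 0" "c u \<noteq> 0" by (auto simp: walk_part_def split: if_splits)
        then have "(w, u) \<in> ?r"
          using walk_coloured_lex_least[OF wW srt u False q(2)] w by auto
        then show False using max \<open>c u \<noteq> 0\<close> by blast
      qed
      then show ?thesis using False V by (simp add: scale_zero_left eval_word_closed)
    qed
  qed
  also have "\<dots> = alg_scale A (c w) (eval_word A V w)" using wW by simp
  finally have "alg_scale A (inverse (c w)) (alg_scale A (c w) (eval_word A V w)) = 0"
    by (simp add: scale_zero_right)
  then have "eval_word A V w = 0"
    using w V by (simp add: scale_scale scale_one eval_word_closed)
  then show False using eval nz(2) by simp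
qed

section \<open>Matrix algebras of different sizes\<close>

text \<open>Matrices vanish outside their range, so the smaller algebra is literally the upper left
  corner of the larger one, and the additional terms of a product are zero.\<close>

lemma eval_word_mat_alg_mono:
  assumes "s \<le> r" "\<And>i. v i \<in> alg_carrier (mat_alg s A)"
  shows "eval_word (mat_alg r A) v w = eval_word (mat_alg s A) v w"
proof (induction w)
  case (Cons x w)
  interpret S: assoc_algebra "mat_alg s A" by (rule assoc_algebra_mat_alg)
  show ?case
  proof (cases "w = []")
    case False
    let ?e = "eval_word (mat_alg s A) v w"
    have "?e \<in> alg_carrier (mat_alg s A)" using assms(2) by (rule S.eval_word_closed)
    then have e: "?e i j \<in> alg_carrier A" for i j by (rule mat_alg_entry)
    have "v x i k = 0" if "k \<notin> {..<s}" for i k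
      using assms(2)[of x] that by (auto simp: mat_alg_def)
    then have "(\<Sum>k<r. alg_mult A (v x i k) (?e k j)) = (\<Sum>k<s. alg_mult A (v x i k) (?e k j))" for i j
      using assms(1) by (intro sum.mono_neutral_right) (auto simp: mult_zero_left e)
    then show ?thesis using Cons.IH False by (simp add: eval_word_Cons mat_alg_def)
  qed simp
qed simp

lemma identities_mat_alg_antimono:
  assumes "s \<le> r"
  shows "identities (mat_alg r A) \<subseteq> identities (mat_alg s A)"
proof
  fix f assume f: "f \<in> identities (mat_alg r A)"
  have "eval_poly (mat_alg s A) v f = 0" if v: "\<forall>i. v i \<in> alg_carrier (mat_alg s A)" for v
  proof -
    have "v i \<in> alg_carrier (mat_alg r A)" for i
    proof -
      have "v i \<in> alg_carrier (mat_alg s A)" using v by simp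
      then have "v i j k \<in> alg_carrier A" "\<not> (j < s \<and> k < s) \<Longrightarrow> v i j k = 0" for j k
        by (rule mat_alg_entry) (use v in \<open>simp add: mat_alg_def\<close>)
      then show ?thesis using assms by (auto simp: mat_alg_def)
    qed
    then have "eval_poly (mat_alg r A) v f = 0" using f by (simp add: identities_def)
    moreover have "eval_poly (mat_alg r A) v f = eval_poly (mat_alg s A) v f"
      using v by (simp add: eval_poly_def eval_word_mat_alg_mono[OF assms]) (simp add: mat_alg_def)
    ultimately show ?thesis by simp
  qed
  then show "f \<in> identities (mat_alg s A)" using f by (simp add: identities_def)
qed

end

subsection \<open>Comparison of identities\<close>

text \<open>\<open>L ^ L / fact L\<close> is one term of the exponential series at \<open>L\<close>,
  and \<open>exp 1\<close> is at most \<open>3\<close>.\<close>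

lemma self_power_le_fact: "L ^ L \<le> 3 ^ L * (fact L :: nat)"
proof -
  have "real L ^ L / fact L \<le> exp (real L)"
  proof -
    have "(\<lambda>n. real L ^ n / fact n) sums exp (real L)"
      using exp_converges[of "real L"] by (simp add: divide_inverse mult.commute)
    then show ?thesis
      using sum_le_suminf[of "\<lambda>n. real L ^ n / fact n" "{L}"] by (auto simp: sums_iff)
  qed
  also have "exp (real L) = exp 1 ^ L" by (simp add: exp_of_nat_mult[symmetric])
  also have "\<dots> \<le> 3 ^ L" using exp_le by (intro power_mono) auto
  finally have "real (L ^ L) \<le> real (3 ^ L * fact L)" by (simp add: divide_le_eq)
  then show ?thesis by (simp only: of_nat_le_iff)
qed

text \<open>After multiplication by \<open>9 ^ (L * L)\<close>, and with \<open>n ^ 2\<close> at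
  most \<open>4 ^ (L * L)\<close>, the left side is at most
  \<open>(6 * D * n) ^ (2 * (L * L))\<close>. The right side is then at least
  \<open>(L ^ L) ^ (2 * L)\<close>.\<close>

lemma grid_count_bound:
  assumes "6 * D * n < L" "n \<le> L"
  shows "n ^ (2 * (L * L) + 2) * D ^ (2 * (L * L)) < fact L ^ (2 * L)"
proof -
  let ?m = "L * L"
  have L: "0 < L" using assms by simp
  have "n \<le> 2 ^ ?m"
  proof -
    have "n \<le> 2 ^ L" using assms(2) less_exp[of L] by linarith
    also have "\<dots> \<le> 2 ^ ?m" by (intro power_increasing) auto
    finally show ?thesis .
  qed
  then have "n ^ 2 \<le> (2 ^ ?m) ^ 2" by (rule power_mono) simp
  also have "\<dots> = (2 ^ 2) ^ ?m" by (simp only: power_mult[symmetric] mult.commute)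
  finally have n2: "n ^ 2 \<le> 4 ^ ?m" by simp
  have "9 ^ ?m * (n ^ (2 * ?m + 2) * D ^ (2 * ?m)) = (9 ^ ?m * n ^ 2) * (n ^ (2 * ?m) * D ^ (2 * ?m))"
    by (simp add: power_add ac_simps power2_eq_square)
  also have "\<dots> \<le> (9 ^ ?m * 4 ^ ?m) * (n ^ (2 * ?m) * D ^ (2 * ?m))"
    using n2 by (intro mult_le_mono) auto
  also have "\<dots> = (6 * D * n) ^ (2 * ?m)"
    by (simp add: power_mult_distrib power_mult) (simp flip: power_mult_distrib)
  also have "\<dots> < L ^ (2 * ?m)" using assms(1) L by (intro power_strict_mono) auto
  also have "\<dots> = (L ^ L) ^ (2 * L)" by (simp add: power_mult[symmetric] ac_simps)
  also have "\<dots> \<le> (3 ^ L * fact L) ^ (2 * L)" by (intro power_mono self_power_le_fact) simp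
  also have "\<dots> = 9 ^ ?m * fact L ^ (2 * L)"
  proof -
    have "((3::nat) ^ L) ^ (2 * L) = (3 ^ 2) ^ ?m" by (simp only: power_mult[symmetric] ac_simps)
    then show ?thesis by (simp add: power_mult_distrib)
  qed
  finally show ?thesis by simp
qed

lemma power_ratio_unbounded:
  fixes r s K :: nat
  assumes "r < s" "0 < r"
  shows "\<exists>k. K * r ^ k \<le> s ^ k"
proof -
  have "1 < real s / real r" using assms by simp
  then obtain k where "real K < (real s / real r) ^ k" using real_arch_pow by blast
  then have "real (K * r ^ k) < real (s ^ k)" using assms(2) by (simp add: power_divide field_simps)
  then show ?thesis by (metis less_imp_le of_nat_less_iff)
qed

lemma not_identities_mat_alg_subset:
  fixes R :: "('k::field, 'a::ab_group_add) alg"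
  assumes R: "PI_algebra R" "PI_exp R \<noteq> 0" and rs: "0 < r" "r < s"
  shows "\<not> identities (mat_alg r R) \<subseteq> identities (mat_alg s R)"
proof
  assume sub: "identities (mat_alg r R) \<subseteq> identities (mat_alg s R)"
  interpret assoc_algebra R using R(1) by (simp add: PI_algebra_def)
  have "0 \<in> identities R" using subspace_identities ncpoly.subspace_0 by blast
  then obtain f where "f \<in> identities R" "f \<noteq> 0" using R(1) by (auto simp: PI_algebra_def)
  then obtain D \<gamma> where \<gamma>: "multi_identity R (Suc D) \<gamma>" "\<gamma> [0..<Suc D] \<noteq> 0"
    using multi_identity_exists by (metis gr0_implies_Suc)
  \<comment> \<open>The constant \<open>12 * D + 4\<close> makes room for \<open>2 * L\<close> with
    the \<open>L\<close> chosen next, since \<open>n\<close> is positive.\<close>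
  obtain k where k: "(12 * D + 4) * r ^ k \<le> s ^ k" using power_ratio_unbounded[OF rs(2,1)] by blast
  define n N L m where "n = r ^ k" "N = s ^ k" "L = (6 * D + 1) * n + 1" "m = L * L"
  note defs = this
  have pos: "0 < n" "0 < N" "0 < m" using rs by (auto simp: defs)
  have LN: "2 * L \<le> N"
  proof -
    have "2 * L = (12 * D + 2) * n + 2" by (simp add: defs algebra_simps)
    also have "\<dots> \<le> (12 * D + 4) * n" using pos(1) by (simp add: algebra_simps)
    finally show ?thesis using k by (simp add: defs)
  qed
  define G where "G = {w \<in> permutations_of_set {..<m}. colourable D w}"
  define U where "U = {w \<in> permutations_of_set {..<m}. colourable N w}"
  have "n ^ (2 * m + 2) * card G \<le> n ^ (2 * m + 2) * D ^ (2 * m)"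
    unfolding G_def by (intro mult_le_mono card_colourable_le order_refl)
  also have "\<dots> < fact L ^ (2 * L)"
    unfolding defs(4) by (intro grid_count_bound) (auto simp: defs(3) algebra_simps)
  also have "\<dots> \<le> card {w \<in> permutations_of_set {..<m}. colourable (2 * L) w}"
    unfolding defs(4) by (rule card_colourable_ge)
  also have "\<dots> \<le> card U"
    unfolding U_def using colourable_mono[OF _ LN] by (intro card_mono) auto
  finally have card: "n ^ (2 * m + 2) * card G < card U" .
  have "\<exists>c. (\<exists>w. c w \<noteq> 0) \<and> (\<forall>w. c w \<noteq> 0 \<longrightarrow> w \<in> U) \<and> walk_identity R n m c"
    using spanned_by_colourable[OF \<gamma> G_def] card
    by (intro walk_identity_exists[where G = G]) (auto simp: G_def U_def)
  then obtain c where c: "\<exists>w. c w \<noteq> 0" "\<And>w. c w \<noteq> 0 \<Longrightarrow> w \<in> U" "walk_identity R n m c" by blast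
  \<comment> \<open>For multilinear polynomials of degree \<open>m\<close> the assumed inclusion is
    a statement about walk identities, which passes to powers.\<close>
  have "walk_identity R s m c'" if "walk_identity R r m c'" for c'
  proof -
    interpret r: assoc_algebra "mat_alg r R" by (rule assoc_algebra_mat_alg)
    interpret s: assoc_algebra "mat_alg s R" by (rule assoc_algebra_mat_alg)
    show ?thesis
      using that sub rs pos(3)
      by (auto simp flip: multi_identity_mat_alg_iff r.multi_poly_identity_iff s.multi_poly_identity_iff)
  qed
  then have "walk_identity R N m c" using c(3) unfolding defs(1,2) by (rule walk_identity_power)
  \<comment> \<open>Otherwise all products of \<open>m\<close> factors would vanish and the exponent
    would be \<open>0\<close>.\<close>
  moreover have "\<exists>v. (\<forall>i. v i \<in> alg_carrier R) \<and> eval_word R v [0..<m] \<noteq> 0"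
    using PI_exp_nilpotent[OF assoc_algebra_axioms pos(3)] R(2) by blast
  then have "\<not> walk_identity R N m c"
    using not_walk_identity[of _ m N c] pos c(1,2) by (auto simp: U_def)
  ultimately show False by simp
qed

theorem corollary3:
  fixes R :: "('k::field_char_0, 'a::ab_group_add) alg" and r s :: nat
  assumes "PI_algebra R" and "PI_exp R \<ge> 1"
    and "r \<ge> 1" and "s \<ge> 1"
  shows "(identities (mat_alg r R) \<subseteq> identities (mat_alg s R) \<longleftrightarrow> r \<ge> s) \<and>
         (identities (mat_alg r R) = identities (mat_alg s R) \<longleftrightarrow> r = s)"
proof -
  interpret assoc_algebra R using assms(1) by (simp add: PI_algebra_def)
  have sub: "identities (mat_alg a R) \<subseteq> identities (mat_alg b R) \<longleftrightarrow> b \<le> a" if "0 < a" for a b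
    using identities_mat_alg_antimono not_identities_mat_alg_subset[OF assms(1) _ that] assms(2)
    by (metis not_less not_one_le_zero)
  have "identities (mat_alg r R) \<subseteq> identities (mat_alg s R) \<longleftrightarrow> s \<le> r"
    "identities (mat_alg s R) \<subseteq> identities (mat_alg r R) \<longleftrightarrow> r \<le> s"
    using assms(3,4) by (auto simp only: sub)
  then show ?thesis by (metis order_antisym order_refl)
qed

end
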